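(* Let $g$ be a Gårding-Dirichlet polynomial of degree $N\ge1$ on $S(n)$ with Gårding cone $\Gamma$, edge $E$ and open polar $\Gamma^*$. Then the gradient map $$F=D\log g:\ \Gamma/E\longrightarrow\Gamma^*,\qquad F(A)=D_A\log g,$$ is a (well-defined) diffeomorphism. Moreover, at a point $A\in\Gamma$ the Jacobian $F'(A)=D_A^2\log g$, expressed as a quadratic form on $S(n)/E$, is the negative definite form $$F'(A)(B,B)=-\sum_{j=1}^N\bigl(\lambda_j^A(B)\bigr)^2,\qquad B\in S(n)/E=S .$$
   Context: $S(n)$ is the space of real symmetric $n\times n$ matrices with inner product $\langle A,B\rangle=\mathrm{tr}(AB)$, used to identify $S(n)^*$ with $S(n)$, and $\mathcal P=\{A\in S(n):A\ge0\}$. A Gårding-Dirichlet polynomial (operator) of degree $N$ is a homogeneous real polynomial $g$ of degree $N$ on $S(n)$ such that $g(I)>0$, $t\mapsto g(tI+A)$ has all real roots for every $A\in S(n)$, and the Gårding cone $\Gamma$, i.e. the connected component of $\{g\ne0\}$ containing $I$ (an open convex cone), satisfies $\mathcal P\subset\overline\Gamma$. The edge is the linear subspace $E=\overline\Gamma\cap(-\overline\Gamma)$; $g$ is invariant under translation by elements of $E$. The span is $S=E^\perp$, identified with $S(n)/E$. The open polar $\Gamma^*$ is the interior, relative to its span $S$, of $\Gamma^0=\{B\in S(n):\langle B,A\rangle\ge0\ \forall A\in\Gamma\}$. $\Gamma/E\cong\Gamma\cap S$ denotes the image of $\Gamma$ in $S(n)/E$. For $A\in\Gamma$ and $B\in S(n)$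 the $A$-eigenvalues $\lambda_1^A(B),\dots,\lambda_N^A(B)\in\mathbb{R}$ of $B$ are defined (up to order) by $g(tA+B)=g(A)\prod_{j=1}^N(t+\lambda_j^A(B))$ for all $t\in\mathbb{R}$; they depend only on $B$ modulo $E$. *)

theory Defs
  imports "HOL-Analysis.Analysis" "HOL-Computational_Algebra.Polynomial"
begin

section \<open>The Euclidean space of real symmetric matrices\<close>

typedef ('n::finite) symmat = "{M :: real^'n^'n. transpose M = M}"
  morphisms mat_of symmat
  by (rule exI[of _ 0]) (simp add: transpose_def vec_eq_iff)

setup_lifting type_definition_symmat

instantiation symmat :: (finite) real_vector
begin

lift_definition zero_symmat :: "'a symmat" is 0
  by (simp add: transpose_def vec_eq_iff)

lift_definition plus_symmat :: "'a symmat \<Rightarrow> 'a symmat \<Rightarrow> 'a symmat" is "(+)"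
  by (simp add: transpose_def vec_eq_iff)

lift_definition minus_symmat :: "'a symmat \<Rightarrow> 'a symmat \<Rightarrow> 'a symmat" is "(-)"
  by (simp add: transpose_def vec_eq_iff)

lift_definition uminus_symmat :: "'a symmat \<Rightarrow> 'a symmat" is uminus
  by (simp add: transpose_def vec_eq_iff)

lift_definition scaleR_symmat :: "real \<Rightarrow> 'a symmat \<Rightarrow> 'a symmat" is "(*\<^sub>R)"
  by (simp add: transpose_def vec_eq_iff)

instance
  by standard (transfer; simp add: algebra_simps)+

end

lemma trace_mult_symmetric:
  fixes A B :: "real^'n^'n"
  assumes "transpose A = A"
  shows "trace (A ** B) = inner A B"
proof -
  have sym: "A $ i $ j = A $ j $ i" for i j
    using assms by (metis transpose_def vec_lambda_beta)
  have "trace (A ** B) = (\<Sum>i\<in>UNIV. \<Sum>j\<in>UNIV. A $ i $ j * B $ j $ i)"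
    by (simp add: trace_def matrix_matrix_mult_def)
  also have "\<dots> = (\<Sum>i\<in>UNIV. \<Sum>j\<in>UNIV. A $ j $ i * B $ j $ i)"
    by (intro sum.cong refl) (metis sym)
  also have "\<dots> = (\<Sum>j\<in>UNIV. \<Sum>i\<in>UNIV. A $ j $ i * B $ j $ i)"
    by (rule sum.swap)
  also have "\<dots> = inner A B"
    by (simp add: inner_vec_def)
  finally show ?thesis .
qed

instantiation symmat :: (finite) real_inner
begin

lift_definition inner_symmat :: "'a symmat \<Rightarrow> 'a symmat \<Rightarrow> real"
  is "\<lambda>A B. trace (A ** B)" .

definition norm_symmat :: "'a symmat \<Rightarrow> real" where
  "norm_symmat A = sqrt (inner A A)"

definition sgn_symmat :: "'a symmat \<Rightarrow> 'a symmat" where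
  "sgn_symmat A = A /\<^sub>R norm A"

definition dist_symmat :: "'a symmat \<Rightarrow> 'a symmat \<Rightarrow> real" where
  "dist_symmat A B = norm (A - B)"

definition uniformity_symmat :: "('a symmat \<times> 'a symmat) filter" where
  "uniformity_symmat = (INF e\<in>{0<..}. principal {(A, B). dist A B < e})"

definition open_symmat :: "'a symmat set \<Rightarrow> bool" where
  "open_symmat U = (\<forall>A\<in>U. eventually (\<lambda>(A', B). A' = A \<longrightarrow> B \<in> U) uniformity)"

lemma inner_symmat_mat_of: "inner A B = inner (mat_of A) (mat_of B)" for A B :: "'a symmat"
  by transfer (simp add: trace_mult_symmetric)

instance
proof
  fix A B C :: "'a symmat" and r :: real
  show "inner A B = inner B A"
    by (simp add: inner_symmat_mat_of inner_commute)
  show "inner (A + B) C = inner A C + inner B C"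
    by (simp add: inner_symmat_mat_of plus_symmat.rep_eq inner_add_left)
  show "inner (r *\<^sub>R A) B = r * inner A B"
    by (simp add: inner_symmat_mat_of scaleR_symmat.rep_eq)
  show "0 \<le> inner A A"
    by (simp add: inner_symmat_mat_of)
  show "inner A A = 0 \<longleftrightarrow> A = 0"
    by (simp add: inner_symmat_mat_of zero_symmat.rep_eq flip: mat_of_inject)
qed (simp_all add: norm_symmat_def sgn_symmat_def dist_symmat_def uniformity_symmat_def
      open_symmat_def)

end

lemma symmat_orthonormal_basis:
  "\<exists>X :: ('n::finite) symmat set. X \<noteq> {} \<and> finite X \<and>
     (\<forall>u\<in>X. \<forall>v\<in>X. inner u v = (if u = v then 1 else 0)) \<and>
     (\<forall>x. (\<forall>u\<in>X. inner x u = 0) \<longleftrightarrow> x = 0)"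
proof -
  let ?T = "{M :: real^'n^'n. transpose M = M}"
  have sub: "subspace ?T"
    by (auto simp: subspace_def transpose_def vec_eq_iff)
  obtain B where B: "B \<subseteq> ?T" "pairwise orthogonal B" "\<And>x. x \<in> B \<Longrightarrow> norm x = 1"
      "independent B" "card B = dim ?T" "span B = ?T"
    by (rule orthonormal_basis_subspace[OF sub]) (rule that)
  let ?X = "symmat ` B"
  have inv: "mat_of (symmat M) = M" if "M \<in> B" for M
    using symmat_inverse[of M] B(1) that by auto
  have fin: "finite ?X"
    using B(4) independent_imp_finite by blast
  have ortho: "\<forall>u\<in>?X. \<forall>v\<in>?X. inner u v = (if u = v then 1 else 0)"
  proof (intro ballI)
    fix u v assume "u \<in> ?X" "v \<in> ?X"
    then obtain M K where MK: "M \<in> B" "K \<in> B" "u = symmat M" "v = symmat K" by auto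
    have mu: "mat_of u = M" using MK(1,3) inv by simp
    have mv: "mat_of v = K" using MK(2,4) inv by simp
    have eq: "u = v \<longleftrightarrow> M = K"
      unfolding mu[symmetric] mv[symmetric] by (rule mat_of_inject[symmetric])
    show "inner u v = (if u = v then 1 else 0)"
    proof (cases "M = K")
      case True
      have "inner M M = 1" using B(3)[OF MK(1)] by (simp add: norm_eq_1)
      with True show ?thesis by (simp only: inner_symmat_mat_of mu mv eq) simp
    next
      case False
      then have "inner M K = 0" using B(2) MK(1,2) by (simp add: pairwise_def orthogonal_def)
      with False show ?thesis by (simp only: inner_symmat_mat_of mu mv eq) simp
    qed
  qed
  have zero: "(\<forall>u\<in>?X. inner x u = 0) \<longleftrightarrow> x = 0" for x :: "'n symmat"
  proof
    assume h: "\<forall>u\<in>?X. inner x u = 0"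
    have "orthogonal (mat_of x) M" if "M \<in> B" for M
      using h that inv[OF that] by (auto simp: inner_symmat_mat_of orthogonal_def)
    moreover have "mat_of x \<in> span B"
      using mat_of[of x] B(6) by simp
    ultimately have "orthogonal (mat_of x) (mat_of x)"
      using orthogonal_to_span by blast
    then show "x = 0"
      by (simp add: orthogonal_self zero_symmat.rep_eq flip: mat_of_inject)
  qed simp
  have "symmat (mat 1) \<noteq> (0 :: 'n symmat)"
  proof
    assume "symmat (mat 1) = (0 :: 'n symmat)"
    then have "mat 1 = (0 :: real^'n^'n)"
      using symmat_inverse[of "mat 1 :: real^'n^'n"] by (simp add: zero_symmat.rep_eq)
    then have "(mat 1 :: real^'n^'n) $ i $ i = 0" for i :: 'n by (simp only: zero_index)
    then show False by (simp add: mat_def)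
  qed
  then have ne: "?X \<noteq> {}" using zero[of "symmat (mat 1)"] by auto
  show ?thesis
    by (rule exI[of _ ?X]) (intro conjI allI ne fin ortho zero)
qed

instantiation symmat :: (finite) euclidean_space
begin

definition Basis_symmat :: "'a symmat set" where
  "Basis_symmat = (SOME X. X \<noteq> {} \<and> finite X \<and>
     (\<forall>u\<in>X. \<forall>v\<in>X. inner u v = (if u = v then 1 else 0)) \<and>
     (\<forall>x. (\<forall>u\<in>X. inner x u = 0) \<longleftrightarrow> x = 0))"

instance
proof -
  have *: "(Basis :: 'a symmat set) \<noteq> {} \<and> finite (Basis :: 'a symmat set) \<and>
     (\<forall>u\<in>Basis. \<forall>v\<in>Basis. inner u (v :: 'a symmat) = (if u = v then 1 else 0)) \<and>
     (\<forall>x :: 'a symmat. (\<forall>u\<in>Basis. inner x u = 0) \<longleftrightarrow> x = 0)"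
    unfolding Basis_symmat_def by (rule someI_ex[OF symmat_orthonormal_basis])
  note b = conjunct1[OF *] conjunct1[OF conjunct2[OF *]]
    conjunct1[OF conjunct2[OF conjunct2[OF *]], rule_format]
    conjunct2[OF conjunct2[OF conjunct2[OF *]], THEN spec]
  show "OFCLASS('a symmat, euclidean_space_class)"
    by intro_classes (rule b(1), rule b(2), erule (1) b(3), rule b(4))
qed

end

lift_definition id_symmat :: "('n::finite) symmat" is "mat 1"
  by (simp add: transpose_mat)

definition psd_cone :: "('n::finite) symmat set" where
  "psd_cone = {A. \<forall>v. 0 \<le> inner v (mat_of A *v v)}"


section \<open>Garding-Dirichlet polynomials\<close>

definition homogeneous_polynomial :: "nat \<Rightarrow> ('a::real_normed_vector \<Rightarrow> real) \<Rightarrow> bool" where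
  "homogeneous_polynomial N g \<longleftrightarrow>
     real_polynomial_function g \<and> (\<forall>t A. g (t *\<^sub>R A) = t ^ N * g A)"

text \<open>The function of \<open>t\<close> is given by a univariate polynomial, all of whose complex roots
  are real.\<close>

definition all_roots_real :: "(real \<Rightarrow> real) \<Rightarrow> bool" where
  "all_roots_real f \<longleftrightarrow>
     (\<exists>p :: real poly. p \<noteq> 0 \<and> (\<forall>t. poly p t = f t) \<and>
        (\<forall>z :: complex. poly (map_poly of_real p) z = 0 \<longrightarrow> z \<in> \<real>))"

definition garding_cone :: "(('n::finite) symmat \<Rightarrow> real) \<Rightarrow> 'n symmat set" where
  "garding_cone g = connected_component_set {A. g A \<noteq> 0} id_symmat"

definition garding_dirichlet :: "nat \<Rightarrow> (('n::finite) symmat \<Rightarrow> real) \<Rightarrow> bool" where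
  "garding_dirichlet N g \<longleftrightarrow>
     homogeneous_polynomial N g \<and>
     g id_symmat > 0 \<and>
     (\<forall>A. all_roots_real (\<lambda>t. g (t *\<^sub>R id_symmat + A))) \<and>
     psd_cone \<subseteq> closure (garding_cone g)"

definition edge :: "(('n::finite) symmat \<Rightarrow> real) \<Rightarrow> 'n symmat set" where
  "edge g = closure (garding_cone g) \<inter> uminus ` closure (garding_cone g)"

text \<open>The orthogonal complement of the edge is the model of the quotient by the edge: \<open>\<Gamma>/E\<close> is
  represented by \<open>\<Gamma> \<inter> S\<close>.\<close>

definition garding_span :: "(('n::finite) symmat \<Rightarrow> real) \<Rightarrow> 'n symmat set" where
  "garding_span g = (edge g)\<^sup>\<bottom>"

definition closed_polar :: "(('n::finite) symmat \<Rightarrow> real) \<Rightarrow> 'n symmat set" where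
  "closed_polar g = {B. \<forall>A\<in>garding_cone g. inner B A \<ge> 0}"

definition open_polar :: "(('n::finite) symmat \<Rightarrow> real) \<Rightarrow> 'n symmat set" where
  "open_polar g = top_of_set (garding_span g) interior_of closed_polar g"

text \<open>\<open>lam 1, \<dots>, lam N\<close> is an enumeration of the \<open>A\<close>-eigenvalues of \<open>B\<close>; it is unique only up to
  order, hence the relational form.\<close>

definition garding_eigenvalues ::
    "(('n::finite) symmat \<Rightarrow> real) \<Rightarrow> nat \<Rightarrow> 'n symmat \<Rightarrow> 'n symmat \<Rightarrow> (nat \<Rightarrow> real) \<Rightarrow> bool" where
  "garding_eigenvalues g N A B lam \<longleftrightarrow>
     (\<forall>t. g (t *\<^sub>R A + B) = g A * (\<Prod>j=1..N. t + lam j))"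


section \<open>Gradients, second derivatives, diffeomorphisms\<close>

text \<open>The derivative \<open>D\<^sub>A f\<close>, a linear functional, identified with a vector through the inner
  product.\<close>

definition gradient :: "('a::real_inner \<Rightarrow> real) \<Rightarrow> 'a \<Rightarrow> 'a" where
  "gradient f A = (THE D. GDERIV f A :> D)"

text \<open>\<open>D\<^sup>2\<^sub>A f (B, C)\<close>.\<close>

definition second_derivative :: "('a::real_normed_vector \<Rightarrow> real) \<Rightarrow> 'a \<Rightarrow> 'a \<Rightarrow> 'a \<Rightarrow> real" where
  "second_derivative f A B C =
     frechet_derivative (\<lambda>X. frechet_derivative f (at X) B) (at A) C"

text \<open>\<open>C\<^sup>k\<close> and \<open>C\<^sup>\<infinity>\<close> maps on an open subset of a finite-dimensional space.\<close>

primrec Ck_on :: "nat \<Rightarrow> ('a::euclidean_space \<Rightarrow> 'b::real_normed_vector) \<Rightarrow> 'a set \<Rightarrow> bool" where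
  "Ck_on 0 f U \<longleftrightarrow> continuous_on U f"
| "Ck_on (Suc k) f U \<longleftrightarrow>
     (\<forall>x\<in>U. f differentiable (at x)) \<and>
     (\<forall>v. Ck_on k (\<lambda>x. frechet_derivative f (at x) v) U)"

definition smooth_on_open :: "('a::euclidean_space \<Rightarrow> 'b::real_normed_vector) \<Rightarrow> 'a set \<Rightarrow> bool" where
  "smooth_on_open f U \<longleftrightarrow> (\<forall>k. Ck_on k f U)"

text \<open>Smooth maps on an arbitrary subset of a Euclidean space are those that locally extend to
  smooth maps on open sets. For a relatively open subset of a linear subspace this is
  \<open>C\<^sup>\<infinity>\<close>-smoothness in linear coordinates of the subspace.\<close>

definition smooth_map_on :: "'a::euclidean_space set \<Rightarrow> ('a \<Rightarrow> 'b::euclidean_space) \<Rightarrow> bool" where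
  "smooth_map_on X f \<longleftrightarrow>
     (\<forall>x\<in>X. \<exists>U h. open U \<and> x \<in> U \<and> smooth_on_open h U \<and> (\<forall>y\<in>X \<inter> U. h y = f y))"

definition diffeomorphism_betw ::
    "('a::euclidean_space \<Rightarrow> 'b::euclidean_space) \<Rightarrow> 'a set \<Rightarrow> 'b set \<Rightarrow> bool" where
  "diffeomorphism_betw f X Y \<longleftrightarrow>
     bij_betw f X Y \<and> smooth_map_on X f \<and> smooth_map_on Y (inv_into X f)"

end

theory Submission
  imports Defs "HOL-Computational_Algebra.Fundamental_Theorem_Algebra"
begin

text \<open>Along a line one has \<open>g (A + s B) = g A * (\<Prod>j. 1 + s \<lambda>\<^sub>j)\<close>, where the \<open>\<lambda>\<^sub>j\<close> are the
\<open>A\<close>-eigenvalues of \<open>B\<close>; so the first two derivatives of \<open>log g\<close> at \<open>A\<close> in the direction \<open>B\<close> are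
\<open>\<Sum> \<lambda>\<^sub>j\<close> and \<open>- \<Sum> \<lambda>\<^sub>j\<^sup>2\<close> (\<open>derivatives_in_eigenvalues\<close>). This makes \<open>- log g\<close> convex on
\<open>\<Gamma>\<close>, flat exactly in the directions of the edge, and the theorem is the Legendre duality for this
convex barrier. All of it rests on the eigenvalues being real for every \<open>A \<in> \<Gamma>\<close>, while
hyperbolicity is given in the direction \<open>I\<close> only.

The passage from \<open>I\<close> to \<open>A\<close> is Garding's theorem (\<open>hyperbolic_at\<close>). Write \<open>G x y\<close> for the value of
\<open>g\<close> at the complex vector \<open>x + \<i> y\<close>. Up to homogeneity, hyperbolicity in the direction \<open>y\<close> says
that \<open>G x y \<noteq> 0\<close> for all real \<open>x\<close>. If all eigenvalues of \<open>a\<close> with respect to \<open>e\<close> are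
positive, then the roots \<open>s\<close> of \<open>g (\<tau> x + s a + \<i> e)\<close> lie in the lower half plane for \<open>\<tau> = 0\<close>,
and they can never be real, because \<open>e\<close> is hyperbolic. So none of them leaves the lower
half plane on the way to \<open>\<tau> = 1\<close>, which shows that the directions \<open>e + \<sigma> a\<close> are hyperbolic
(\<open>ray_in_tube\<close>). Applied to \<open>a - \<epsilon> e\<close> this gives \<open>a\<close> itself. As the cone is described by each of
its points in the same way, it is convex, and the edge consists of the directions whose
eigenvalues vanish (\<open>lineality_iff_eigenvalues\<close>).

To apply theorems on open sets of the whole space rather than on the quotient by the edge, the
gradient map is replaced by \<open>A \<mapsto> D log g (A) - P A\<close> with \<open>P\<close> the orthogonal projection onto the
edge. Its derivative is negative definite on the open convex set \<open>\<Gamma>\<close>, so it is injective, and its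
inverse is smooth (\<open>smooth_inverse\<close>). On the span \<open>S\<close> it is the gradient map. The image of the
gradient map is open in \<open>S\<close> and consists of functionals that are nonnegative on \<open>\<Gamma>\<close>, hence lies in
the open polar. Conversely, a point \<open>B\<close> of the open polar grows linearly on the closed cone in \<open>S\<close>, so
\<open>g\<close> attains a maximum on the compact slice where \<open>\<langle>B, A\<rangle> = N\<close>; there the gradient of
\<open>log g\<close> is a multiple of \<open>B\<close>, and Euler's identity \<open>\<langle>D log g (A), A\<rangle> = N\<close> makes the factor
one (\<open>grad_surj\<close>).\<close>

section \<open>Root bounds for complex polynomials\<close>

lemma complex_poly_linear_factors:
  fixes p :: "complex poly"
  assumes "p \<noteq> 0"
  obtains r :: "nat \<Rightarrow> complex"
    where "\<And>z. poly p z = lead_coeff p * (\<Prod>j=1..degree p. z - r j)"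
proof -
  obtain A where A: "size A = degree p" "p = smult (lead_coeff p) (\<Prod>x\<in>#A. [:-x, 1:])"
    using alg_closed_imp_factorization[OF assms] by blast
  obtain xs where xs: "A = mset xs" using ex_mset by metis
  have "poly p z = lead_coeff p * (\<Prod>j=1..degree p. z - xs ! (j - 1))" for z
  proof -
    have "poly p z = lead_coeff p * (\<Prod>x\<in>#A. z - x)"
      by (subst A(2)) (simp add: poly_prod_mset image_mset.compositionality o_def)
    also have "(\<Prod>x\<in>#A. z - x) = prod_list (map (\<lambda>x. z - x) xs)"
      by (simp add: xs prod_mset_prod_list flip: mset_map)
    also have "\<dots> = (\<Prod>i<degree p. z - xs ! i)"
      using A(1) by (simp add: prod.list_conv_set_nth xs atLeast0LessThan)
    also have "\<dots> = (\<Prod>j=1..degree p. z - xs ! (j - 1))"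
      unfolding One_nat_def prod.atLeast1_atMost_eq by simp
    finally show ?thesis .
  qed
  then show ?thesis by (rule that)
qed

text \<open>A quantitative form of having no root in the open upper half plane: each root is at distance at least
\<open>Im z\<close> from \<open>z\<close>. Unlike the absence of roots, the inequality survives limits of polynomials whose
leading coefficients and degrees are fixed, which is how roots are followed below.\<close>

lemma poly_lower_bound_upper_half_plane:
  fixes p :: "complex poly"
  assumes nz: "\<And>z. Im z > 0 \<Longrightarrow> poly p z \<noteq> 0" and z: "Im z > 0"
  shows "cmod (lead_coeff p) * Im z ^ degree p \<le> cmod (poly p z)"
proof -
  have "p \<noteq> 0" using nz[OF z] by auto
  then obtain r where r: "\<And>z. poly p z = lead_coeff p * (\<Prod>j=1..degree p. z - r j)"
    using complex_poly_linear_factors by blast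
  have "Im (r j) \<le> 0" if "j \<in> {1..degree p}" for j
  proof (rule ccontr)
    assume "\<not> ?thesis"
    then have "poly p (r j) \<noteq> 0" by (intro nz) auto
    moreover have "poly p (r j) = 0" unfolding r using that by auto
    ultimately show False by simp
  qed
  then have "Im z \<le> cmod (z - r j)" if "j \<in> {1..degree p}" for j
    using abs_Im_le_cmod[of "z - r j"] that by force
  then have "(\<Prod>j=1..degree p. Im z) \<le> (\<Prod>j=1..degree p. cmod (z - r j))"
    using z by (intro prod_mono) auto
  then show ?thesis
    unfolding r norm_mult prod_norm[symmetric] by (simp add: mult_left_mono)
qed

lemma complex_poly_eq_if_eq_on_reals:
  fixes p q :: "complex poly"
  assumes "\<And>t::real. poly p (of_real t) = poly q (of_real t)"
  shows "p = q"
proof (rule ccontr)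
  assume "p \<noteq> q"
  then have "finite {z. poly (p - q) z = 0}" by (intro poly_roots_finite) auto
  moreover have "range complex_of_real \<subseteq> {z. poly (p - q) z = 0}" using assms by auto
  moreover have "infinite (range complex_of_real)"
    by (simp add: finite_image_iff inj_def infinite_UNIV_char_0)
  ultimately show False using finite_subset by blast
qed

text \<open>Comparison with the reflected polynomial of \<open>q\<close>, whose leading coefficient is the constant
coefficient of \<open>q\<close>.\<close>

lemma degree_lead_coeff_of_reciprocal:
  fixes p q :: "complex poly"
  assumes pq: "\<And>z. z \<noteq> 0 \<Longrightarrow> poly p z = z ^ N * poly q (1 / z)" and q0: "poly q 0 \<noteq> 0"
  shows "degree p = N" "lead_coeff p = poly q 0"
proof -
  have q: "coeff q 0 \<noteq> 0" "q \<noteq> 0" using q0 by (auto simp: poly_0_coeff_0)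
  have "poly (monom 1 (degree q) * p) z = poly (monom 1 N * reflect_poly q) z" if "z \<noteq> 0" for z
    using that by (simp add: poly_monom pq poly_reflect_poly_nz inverse_eq_divide)
  then have "- {0} \<subseteq> {z. poly (monom 1 (degree q) * p - monom 1 N * reflect_poly q) z = 0}"
    by auto
  moreover have "infinite (- {0::complex})"
    by (simp add: infinite_UNIV_char_0)
  ultimately have eq: "monom 1 (degree q) * p = monom 1 N * reflect_poly q"
    using poly_roots_finite[of "monom 1 (degree q) * p - monom 1 N * reflect_poly q"]
      finite_subset by fastforce
  have p: "p \<noteq> 0" using eq q by auto
  have "degree q + degree p = N + degree q"
    using arg_cong[OF eq, of degree] p q
    by (simp add: degree_mult_eq degree_monom_eq degree_reflect_poly_eq)
  then show "degree p = N" by simp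
  have "lead_coeff (monom 1 (degree q) * p) = lead_coeff (monom 1 N * reflect_poly q)"
    by (simp only: eq)
  then show "lead_coeff p = poly q 0"
    unfolding lead_coeff_mult using q(1)
    by (simp add: lead_coeff_monom degree_monom_eq poly_0_coeff_0 coeff_reflect_poly
        degree_reflect_poly_eq)
qed

section \<open>Complex extension of a real polynomial function\<close>

text \<open>Here \<open>G x y\<close> stands for the value at the complex vector \<open>x + \<i> y\<close>. The last condition says that it is
a polynomial along each complex line \<open>w + z (u + \<i> v)\<close>, written in real and imaginary parts.\<close>

definition is_complex_extension ::
    "('a::real_normed_vector \<Rightarrow> real) \<Rightarrow> ('a \<Rightarrow> 'a \<Rightarrow> complex) \<Rightarrow> bool" where
  "is_complex_extension g G \<longleftrightarrow>
     continuous_on UNIV (\<lambda>w. G (fst w) (snd w)) \<and> (\<forall>x. G x 0 = of_real (g x)) \<and>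
     (\<forall>x y u v. \<exists>p. \<forall>z. poly p z =
        G (x + Re z *\<^sub>R u - Im z *\<^sub>R v) (y + Im z *\<^sub>R u + Re z *\<^sub>R v))"

text \<open>A polynomial function built from linear forms has an evident meaning on complex vectors; the induction
only has to carry along that it is a polynomial on each complex line.\<close>

lemma ex_complex_extension:
  assumes "real_polynomial_function g"
  shows "\<exists>G. is_complex_extension g G"
  using assms
proof (induction rule: real_polynomial_function.induct)
  case (linear f)
  then interpret bounded_linear f .
  have "\<exists>p. \<forall>z. poly p z = Complex (f (x + Re z *\<^sub>R u - Im z *\<^sub>R v)) (f (y + Im z *\<^sub>R u + Re z *\<^sub>R v))"
    for x y u v
    by (rule exI[of _ "[:Complex (f x) (f y), Complex (f u) (f v):]"])
       (simp add: add diff scale complex_eq_iff algebra_simps)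
  moreover have "continuous_on UNIV (\<lambda>w. Complex (f (fst w)) (f (snd w)))"
    unfolding Complex_eq by (intro continuous_intros continuous_on) 
  moreover have "Complex (f x) (f 0) = of_real (f x)" for x
    by (simp add: zero complex_eq_iff)
  ultimately show ?case unfolding is_complex_extension_def
    by (intro exI[of _ "\<lambda>x y. Complex (f x) (f y)"]) auto
next
  case (const c)
  show ?case unfolding is_complex_extension_def
    by (rule exI[of _ "\<lambda>x y. of_real c"]) (auto intro: exI[of _ "[:of_real c:]"])
next
  case (add f g)
  then obtain F G where FG: "is_complex_extension f F" "is_complex_extension g G" by auto
  have "\<exists>p. \<forall>z. poly p z = F (x + Re z *\<^sub>R u - Im z *\<^sub>R v) (y + Im z *\<^sub>R u + Re z *\<^sub>R v)
      + G (x + Re z *\<^sub>R u - Im z *\<^sub>R v) (y + Im z *\<^sub>R u + Re z *\<^sub>R v)" for x y u v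
    using FG unfolding is_complex_extension_def by (metis poly_add)
  with FG show ?case unfolding is_complex_extension_def
    by (intro exI[of _ "\<lambda>x y. F x y + G x y"]) (auto intro!: continuous_intros)
next
  case (mult f g)
  then obtain F G where FG: "is_complex_extension f F" "is_complex_extension g G" by auto
  have "\<exists>p. \<forall>z. poly p z = F (x + Re z *\<^sub>R u - Im z *\<^sub>R v) (y + Im z *\<^sub>R u + Re z *\<^sub>R v)
      * G (x + Re z *\<^sub>R u - Im z *\<^sub>R v) (y + Im z *\<^sub>R u + Re z *\<^sub>R v)" for x y u v
    using FG unfolding is_complex_extension_def by (metis poly_mult)
  with FG show ?case unfolding is_complex_extension_def
    by (intro exI[of _ "\<lambda>x y. F x y * G x y"]) (auto intro!: continuous_intros)
qed

definition complex_extension :: "('a::real_normed_vector \<Rightarrow> real) \<Rightarrow> 'a \<Rightarrow> 'a \<Rightarrow> complex" where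
  "complex_extension g = (SOME G. is_complex_extension g G)"

lemma is_complex_extension:
  assumes "real_polynomial_function g"
  shows "is_complex_extension g (complex_extension g)"
  unfolding complex_extension_def by (rule someI_ex[OF ex_complex_extension[OF assms]])

lemma continuous_complex_extension:
  assumes "real_polynomial_function g" "continuous_on X u" "continuous_on X v"
  shows "continuous_on X (\<lambda>s. complex_extension g (u s) (v s))"
proof -
  have "continuous_on UNIV (\<lambda>w. complex_extension g (fst w) (snd w))"
    using is_complex_extension[OF assms(1)] by (simp add: is_complex_extension_def)
  then have "continuous_on X (\<lambda>s. complex_extension g (fst (u s, v s)) (snd (u s, v s)))"
    by (rule continuous_on_compose2) (auto intro!: continuous_on_Pair assms)
  then show ?thesis by simp
qed

lemma complex_extension_real:
  assumes "real_polynomial_function g"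
  shows "complex_extension g x 0 = of_real (g x)"
  using is_complex_extension[OF assms] by (simp add: is_complex_extension_def)

lemma complex_extension_line:
  fixes x y u v :: "'a::real_normed_vector"
  assumes "real_polynomial_function g"
  shows "\<exists>p. \<forall>z. poly p z = complex_extension g
      (x + Re z *\<^sub>R u - Im z *\<^sub>R v) (y + Im z *\<^sub>R u + Re z *\<^sub>R v)"
  using is_complex_extension[OF assms] unfolding is_complex_extension_def by blast

text \<open>Both sides are polynomials in \<open>z\<close> after \<open>y\<close> has been replaced by \<open>z y\<close>, and they agree for
real \<open>z\<close> because \<open>g\<close> is homogeneous; the claim is the case \<open>z = \<i>\<close>.\<close>

lemma complex_extension_homogeneous_real:
  assumes "homogeneous_polynomial N g"
  shows "complex_extension g (t *\<^sub>R x) (t *\<^sub>R y) = of_real t ^ N * complex_extension g x y"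
proof -
  have g: "real_polynomial_function g" "\<And>t x. g (t *\<^sub>R x) = t ^ N * g x"
    using assms by (auto simp: homogeneous_polynomial_def)
  obtain p where p: "\<And>z. poly p z = complex_extension g
      (t *\<^sub>R x + Re z *\<^sub>R (t *\<^sub>R y) - Im z *\<^sub>R 0) (0 + Im z *\<^sub>R (t *\<^sub>R y) + Re z *\<^sub>R 0)"
    using complex_extension_line[OF g(1), of "t *\<^sub>R x" "t *\<^sub>R y" 0 0] by blast
  obtain q where q: "\<And>z. poly q z = complex_extension g
      (x + Re z *\<^sub>R y - Im z *\<^sub>R 0) (0 + Im z *\<^sub>R y + Re z *\<^sub>R 0)"
    using complex_extension_line[OF g(1), of x y 0 0] by blast
  have "p = smult (of_real t ^ N) q"
  proof (rule complex_poly_eq_if_eq_on_reals)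
    fix s :: real
    have "t *\<^sub>R x + s *\<^sub>R t *\<^sub>R y = t *\<^sub>R (x + s *\<^sub>R y)" by (simp add: algebra_simps)
    then show "poly p (of_real s) = poly (smult (of_real t ^ N) q) (of_real s)"
      by (simp add: p q complex_extension_real[OF g(1)] g(2))
  qed
  then have "poly p \<i> = of_real t ^ N * poly q \<i>" by simp
  then show ?thesis by (simp add: p q)
qed

lemma complex_extension_homogeneous:
  assumes "homogeneous_polynomial N g"
  shows "complex_extension g (Re z *\<^sub>R x - Im z *\<^sub>R y) (Im z *\<^sub>R x + Re z *\<^sub>R y)
    = z ^ N * complex_extension g x y"
proof -
  have g: "real_polynomial_function g"
    using assms by (auto simp: homogeneous_polynomial_def)
  obtain p where p: "\<And>z. poly p z = complex_extension g
      (0 + Re z *\<^sub>R x - Im z *\<^sub>R y) (0 + Im z *\<^sub>R x + Re z *\<^sub>R y)"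
    using complex_extension_line[OF g, of 0 x y 0] by blast
  have "p = smult (complex_extension g x y) (monom 1 N)"
    by (rule complex_poly_eq_if_eq_on_reals)
       (simp add: p complex_extension_homogeneous_real[OF assms] poly_monom)
  then have "poly p z = complex_extension g x y * z ^ N" by (simp add: poly_monom)
  then show ?thesis by (simp add: p mult.commute)
qed

text \<open>The identity \<open>g (w + z a) = z\<^sup>N g (a + w / z)\<close> for a complex vector \<open>w = x + \<i> y\<close>, in real
and imaginary parts. It turns large \<open>z\<close> into a neighbourhood of \<open>a\<close>.\<close>

lemma complex_extension_reciprocal:
  assumes "homogeneous_polynomial N g" "z \<noteq> 0"
  shows "complex_extension g (x + Re z *\<^sub>R a) (y + Im z *\<^sub>R a) = z ^ N *
    complex_extension g (a + Re (1 / z) *\<^sub>R x - Im (1 / z) *\<^sub>R y) (Im (1 / z) *\<^sub>R x + Re (1 / z) *\<^sub>R y)"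
proof -
  define w where "w = 1 / z"
  have "z * w = 1" using assms(2) by (simp add: w_def)
  then have w: "Re z * Re w - Im z * Im w = 1" "Re z * Im w + Im z * Re w = 0"
    by (simp_all add: complex_eq_iff)
  have "Re z *\<^sub>R (a + Re w *\<^sub>R x - Im w *\<^sub>R y) - Im z *\<^sub>R (Im w *\<^sub>R x + Re w *\<^sub>R y)
      = (Re z * Re w - Im z * Im w) *\<^sub>R x - (Re z * Im w + Im z * Re w) *\<^sub>R y + Re z *\<^sub>R a"
    by (simp add: algebra_simps)
  then have 1: "Re z *\<^sub>R (a + Re w *\<^sub>R x - Im w *\<^sub>R y) - Im z *\<^sub>R (Im w *\<^sub>R x + Re w *\<^sub>R y) = x + Re z *\<^sub>R a"
    by (simp add: w)
  have "Im z *\<^sub>R (a + Re w *\<^sub>R x - Im w *\<^sub>R y) + Re z *\<^sub>R (Im w *\<^sub>R x + Re w *\<^sub>R y)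
      = (Re z * Im w + Im z * Re w) *\<^sub>R x + (Re z * Re w - Im z * Im w) *\<^sub>R y + Im z *\<^sub>R a"
    by (simp add: algebra_simps)
  then have 2: "Im z *\<^sub>R (a + Re w *\<^sub>R x - Im w *\<^sub>R y) + Re z *\<^sub>R (Im w *\<^sub>R x + Re w *\<^sub>R y) = y + Im z *\<^sub>R a"
    by (simp add: w)
  show ?thesis
    using complex_extension_homogeneous[OF assms(1), of z "a + Re w *\<^sub>R x - Im w *\<^sub>R y"
        "Im w *\<^sub>R x + Re w *\<^sub>R y"]
    unfolding 1 2 by (simp only: w_def)
qed

text \<open>The degree and the leading coefficient are read off at infinity, where the line approaches the direction
\<open>a\<close>.\<close>

lemma complex_extension_line_real_direction:
  assumes hom: "homogeneous_polynomial N g" and a: "g a \<noteq> 0"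
  obtains p where "\<And>z. poly p z = complex_extension g (x + Re z *\<^sub>R a) (y + Im z *\<^sub>R a)"
    "degree p = N" "lead_coeff p = of_real (g a)"
proof -
  have g: "real_polynomial_function g"
    using hom by (auto simp: homogeneous_polynomial_def)
  obtain p where p: "\<And>z. poly p z = complex_extension g
      (x + Re z *\<^sub>R a - Im z *\<^sub>R 0) (y + Im z *\<^sub>R a + Re z *\<^sub>R 0)"
    using complex_extension_line[OF g, of x a 0 y] by blast
  obtain q where q: "\<And>z. poly q z = complex_extension g
      (a + Re z *\<^sub>R x - Im z *\<^sub>R y) (0 + Im z *\<^sub>R x + Re z *\<^sub>R y)"
    using complex_extension_line[OF g, of a x y 0] by blast
  have q0: "poly q 0 = of_real (g a)" by (simp add: q complex_extension_real[OF g])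
  have "poly p z = z ^ N * poly q (1 / z)" if "z \<noteq> 0" for z
    using complex_extension_reciprocal[OF hom that, of x a y] by (simp add: p q)
  from degree_lead_coeff_of_reciprocal[OF this] a q0
  have "degree p = N" "lead_coeff p = of_real (g a)" by auto
  with p show ?thesis by (intro that[of p]) auto
qed

section \<open>Hyperbolic directions\<close>

lemma poly_map_poly_of_real:
  "poly (map_poly of_real p :: complex poly) (of_real t) = of_real (poly p t)"
  by (induction p) (simp_all add: map_poly_pCons)

locale hyperbolic_polynomial =
  fixes N :: nat and g :: "'a::euclidean_space \<Rightarrow> real" and e :: 'a
  assumes hom: "homogeneous_polynomial N g"
    and g_e_pos: "g e > 0"
    and real_roots: "\<And>x. all_roots_real (\<lambda>t. g (t *\<^sub>R e + x))"
begin

abbreviation G where "G \<equiv> complex_extension g"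

lemma poly_g: "real_polynomial_function g" and scale_g: "g (t *\<^sub>R x) = t ^ N * g x"
  using hom by (auto simp: homogeneous_polynomial_def)

text \<open>The imaginary parts that no zero of the extension has, that is, the hyperbolic directions.\<close>

definition tube :: "'a set" where
  "tube = {y. \<forall>x. G x y \<noteq> 0}"

lemma tube_scaleR:
  assumes "y \<in> tube" "c \<noteq> 0"
  shows "c *\<^sub>R y \<in> tube"
proof -
  have "G x (c *\<^sub>R y) \<noteq> 0" for x
    using complex_extension_homogeneous_real[OF hom, of c "x /\<^sub>R c" y] assms
    by (auto simp: tube_def)
  then show ?thesis by (simp add: tube_def)
qed

text \<open>A zero \<open>x + \<i> e\<close> would make \<open>\<i>\<close> a root of the real-rooted polynomial \<open>t \<mapsto> g (t e + x)\<close>.\<close>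

lemma e_in_tube: "e \<in> tube"
proof -
  have "G x e \<noteq> 0" for x
  proof
    assume 0: "G x e = 0"
    obtain p :: "real poly" where p: "\<And>t. poly p t = g (t *\<^sub>R e + x)"
        "\<And>z::complex. poly (map_poly of_real p) z = 0 \<Longrightarrow> z \<in> \<real>"
      using real_roots[of x] unfolding all_roots_real_def by blast
    obtain q where q: "\<And>z. poly q z = G (x + Re z *\<^sub>R e - Im z *\<^sub>R 0) (0 + Im z *\<^sub>R e + Re z *\<^sub>R 0)"
      using complex_extension_line[OF poly_g, of x e 0 0] by blast
    have "q = map_poly of_real p"
      by (rule complex_poly_eq_if_eq_on_reals)
         (simp add: q p(1) complex_extension_real[OF poly_g] add.commute poly_map_poly_of_real)
    moreover have "poly q \<i> = 0" by (simp add: q 0)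
    ultimately show False using p(2)[of \<i>] by (simp add: complex_is_Real_iff)
  qed
  then show ?thesis by (simp add: tube_def)
qed

lemma tube_nonreal:
  assumes "y \<in> tube" "Im z \<noteq> 0"
  shows "G (x + Re z *\<^sub>R y) (Im z *\<^sub>R y) \<noteq> 0"
  using tube_scaleR[OF assms] by (simp add: tube_def)

text \<open>Homogeneity scales a nonreal root of \<open>t \<mapsto> g (t a + x)\<close> to the point \<open>\<i>\<close>, up to a change of the
real vector \<open>x\<close>, and there the tube condition excludes it.\<close>

lemma tube_hyperbolic:
  assumes a: "a \<in> tube" "g a > 0"
  shows "hyperbolic_polynomial N g a"
proof
  fix x
  obtain q where q: "\<And>z. poly q z = G (x + Re z *\<^sub>R a - Im z *\<^sub>R 0) (0 + Im z *\<^sub>R a + Re z *\<^sub>R 0)"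
    using complex_extension_line[OF poly_g, of x a 0 0] by blast
  have "real_polynomial_function (\<lambda>t. g (t *\<^sub>R a + x))"
  proof -
    have "polynomial_function (\<lambda>t::real. t *\<^sub>R a + x)"
      by (intro polynomial_function_add polynomial_function_bounded_linear
          polynomial_function_const bounded_linear_scaleR_left)
    then have "real_polynomial_function (g \<circ> (\<lambda>t. t *\<^sub>R a + x))"
      using poly_g by blast
    then show ?thesis by (simp add: o_def)
  qed
  then obtain c n where "(\<lambda>t. g (t *\<^sub>R a + x)) = (\<lambda>t. \<Sum>i\<le>n. c i * t ^ i)"
    unfolding real_polynomial_function_iff_sum by blast
  then have c: "g (t *\<^sub>R a + x) = (\<Sum>i\<le>n. c i * t ^ i)" for t
    by (rule fun_cong)
  define p where "p = (\<Sum>i\<le>n. monom (c i) i)"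
  have p: "poly p t = g (t *\<^sub>R a + x)" for t
    by (simp add: p_def c poly_sum poly_monom)
  have q_p: "q = map_poly of_real p"
    by (rule complex_poly_eq_if_eq_on_reals)
       (simp add: q p complex_extension_real[OF poly_g] add.commute poly_map_poly_of_real)
  have nz: "poly q z \<noteq> 0" if "Im z \<noteq> 0" for z
    using tube_nonreal[OF a(1) that] by (simp add: q)
  show "all_roots_real (\<lambda>t. g (t *\<^sub>R a + x))"
    unfolding all_roots_real_def
  proof (intro exI conjI allI impI)
    show "p \<noteq> 0" using nz[of \<i>] q_p by auto
    show "z \<in> \<real>" if "poly (map_poly of_real p) z = 0" for z :: complex
      using nz[of z] that q_p by (auto simp: complex_is_Real_iff)
  qed (rule p)
qed (use a hom in auto)

text \<open>All \<open>N\<close> complex roots, counted with multiplicity, are real since \<open>e\<close> lies in the tube.\<close>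

lemma hyperbolic_factorization:
  obtains lam :: "nat \<Rightarrow> real" where "\<And>t. g (t *\<^sub>R e + x) = g e * (\<Prod>j=1..N. t + lam j)"
proof -
  obtain p where p: "\<And>z. poly p z = G (x + Re z *\<^sub>R e) (0 + Im z *\<^sub>R e)"
    "degree p = N" "lead_coeff p = of_real (g e)"
    using complex_extension_line_real_direction[OF hom, of e x 0] g_e_pos by auto
  then have "p \<noteq> 0" using g_e_pos by auto
  then obtain r where r: "\<And>z. poly p z = of_real (g e) * (\<Prod>j=1..N. z - r j)"
    using complex_poly_linear_factors p(2,3) by metis
  have re: "r j = of_real (Re (r j))" if "j \<in> {1..N}" for j
  proof -
    have "poly p (r j) = 0" unfolding r using that by auto
    then have "Im (r j) = 0" using tube_nonreal[OF e_in_tube, of "r j" x] by (auto simp: p(1))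
    then show ?thesis by (simp add: complex_eq_iff)
  qed
  have "g (t *\<^sub>R e + x) = g e * (\<Prod>j=1..N. t + - Re (r j))" for t
  proof -
    have "of_real (g (t *\<^sub>R e + x)) = poly p (of_real t)"
      by (simp add: p complex_extension_real[OF poly_g] add.commute)
    also have "\<dots> = of_real (g e) * (\<Prod>j=1..N. of_real t - of_real (Re (r j)))"
      unfolding r using re by (intro arg_cong2[of _ _ _ _ "(*)"] prod.cong) auto
    also have "\<dots> = of_real (g e * (\<Prod>j=1..N. t + - Re (r j)))"
      by simp
    finally show ?thesis by (simp only: of_real_eq_iff)
  qed
  then show ?thesis by (rule that)
qed

text \<open>The core of Garding's theorem. The hypothesis says that the \<open>e\<close>-eigenvalues of \<open>a\<close> are positive.
For a fixed \<open>x\<close> let \<open>K\<close> be the set of \<open>\<tau> \<in> [0, 1]\<close> for which \<open>s \<mapsto> g (\<tau> x + s a + \<i> e)\<close> has no root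
in the open upper half plane. It contains \<open>0\<close>. It is closed by the lower bound for polynomials
without roots there, and its complement is closed because the roots stay in a compact set and a limit
of roots in the upper half plane is not real. So \<open>K = [0, 1]\<close>, and \<open>s = \<i> \<sigma>\<close>, \<open>\<tau> = 1\<close> is the claim.\<close>

lemma ray_in_tube:
  assumes a: "\<And>t. t \<ge> 0 \<Longrightarrow> g (a + t *\<^sub>R e) \<noteq> 0" and \<sigma>: "\<sigma> \<ge> 0"
  shows "e + \<sigma> *\<^sub>R a \<in> tube"
proof -
  have ga: "g a \<noteq> 0" using a[of 0] by simp
  have "G x (e + \<sigma> *\<^sub>R a) \<noteq> 0" for x
  proof -
    define P where "P \<tau> s = G (\<tau> *\<^sub>R x + Re s *\<^sub>R a) (e + Im s *\<^sub>R a)" for \<tau> s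
    define K where "K = {\<tau>\<in>{0..1}. \<forall>s. Im s > 0 \<longrightarrow> P \<tau> s \<noteq> 0}"
    have cont: "continuous_on X (\<lambda>w. P (t w) (s w))" if "continuous_on X t" "continuous_on X s"
      for X :: "'b::topological_space set" and t s
      unfolding P_def by (intro continuous_complex_extension[OF poly_g] continuous_intros that)
    \<comment> \<open>For \<open>\<tau> = 0\<close> a root \<open>s\<close> gives the root \<open>\<i> / s\<close> of \<open>z \<mapsto> g (a + z e)\<close>, which must be real
      and then positive, against the hypothesis on \<open>a\<close>.\<close>
    have "0 \<in> K"
    proof -
      have "P 0 s \<noteq> 0" if s: "Im s > 0" for s
      proof
        assume "P 0 s = 0"
        moreover have "s \<noteq> 0" using s by auto
        moreover define w where "w = 1 / s"
        ultimately have 0: "G (a + - Im w *\<^sub>R e) (Re w *\<^sub>R e) = 0"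
          using complex_extension_reciprocal[OF hom, of s 0 a e] by (simp add: P_def)
        have "(Re s)\<^sup>2 + (Im s)\<^sup>2 > 0" using s by (simp add: sum_power2_gt_zero_iff)
        then have Im: "- Im w > 0" using s by (simp add: w_def Im_divide)
        have "Re w = 0"
        proof (rule ccontr)
          assume "Re w \<noteq> 0"
          then show False
            using 0 tube_nonreal[OF e_in_tube, of "Complex (- Im w) (Re w)" a] by simp
        qed
        then show False using 0 a[of "- Im w"] Im
          by (simp add: complex_extension_real[OF poly_g])
      qed
      then show ?thesis by (simp add: K_def)
    qed
    have lower: "\<tau> \<in> K \<longleftrightarrow> \<tau> \<in> {0..1} \<and> (\<forall>s\<in>{s. Im s > 0}. \<bar>g a\<bar> * Im s ^ N \<le> cmod (P \<tau> s))" for \<tau>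
    proof -
      obtain p where p: "\<And>z. poly p z = P \<tau> z" "degree p = N" "lead_coeff p = of_real (g a)"
        using complex_extension_line_real_direction[OF hom ga, of "\<tau> *\<^sub>R x" e] by (auto simp: P_def)
      have "\<bar>g a\<bar> * Im s ^ N \<le> cmod (P \<tau> s)" if "\<tau> \<in> K" "Im s > 0" for s
        using poly_lower_bound_upper_half_plane[of p s] that p by (auto simp: K_def)
      moreover have "P \<tau> s \<noteq> 0" if "\<bar>g a\<bar> * Im s ^ N \<le> cmod (P \<tau> s)" "Im s > 0" for s
      proof -
        have "\<bar>g a\<bar> * Im s ^ N > 0" using ga that(2) by simp
        then show ?thesis using that(1) by auto
      qed
      ultimately show ?thesis unfolding K_def mem_Collect_eq by blast
    qed
    have "closed K"
    proof -
      have K: "K = {0..1} \<inter> (\<Inter>s\<in>{s. Im s > 0}. {\<tau>. \<bar>g a\<bar> * Im s ^ N \<le> cmod (P \<tau> s)})"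
        using lower by auto
      show ?thesis unfolding K
        by (intro closed_Int closed_INT ballI closed_Collect_le continuous_intros cont)
    qed
    have real_nz: "P \<tau> s \<noteq> 0" if "Im s = 0" for \<tau> s
      using e_in_tube that by (simp add: P_def tube_def)
    \<comment> \<open>By \<open>complex_extension_reciprocal\<close> a large root would yield a zero of \<open>g\<close> near \<open>a\<close>.\<close>
    obtain R where R: "\<And>\<tau> s. \<tau> \<in> {0..1} \<Longrightarrow> P \<tau> s = 0 \<Longrightarrow> cmod s \<le> R"
    proof -
      have "continuous_on UNIV (\<lambda>w. G (a + fst w) (snd w))"
        by (intro continuous_complex_extension[OF poly_g] continuous_intros)
      then have "open {w. G (a + fst w) (snd w) \<noteq> 0}"
        by (intro open_Collect_neq continuous_intros)
      moreover have "0 \<in> {w. G (a + fst w) (snd w) \<noteq> 0}"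
        using ga by (simp add: complex_extension_real[OF poly_g])
      ultimately obtain r where r: "r > 0" "ball 0 r \<subseteq> {w. G (a + fst w) (snd w) \<noteq> 0}"
        using openE by blast
      have "cmod s \<le> 2 * (norm x + norm e) / r" if \<tau>: "\<tau> \<in> {0..1}" and 0: "P \<tau> s = 0" for \<tau> s
      proof (cases "s = 0")
        case False
        define \<rho> where "\<rho> = 1 / s"
        define w where "w = (Re \<rho> *\<^sub>R \<tau> *\<^sub>R x - Im \<rho> *\<^sub>R e, Im \<rho> *\<^sub>R \<tau> *\<^sub>R x + Re \<rho> *\<^sub>R e)"
        have "G (a + fst w) (snd w) = 0"
          using 0 complex_extension_reciprocal[OF hom False, of "\<tau> *\<^sub>R x" a e] False
          by (simp add: P_def w_def add_diff_eq flip: \<rho>_def)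
        then have "r \<le> norm w" using r(2) by (force simp: not_less)
        also have "norm w \<le> norm (fst w) + norm (snd w)"
          by (metis norm_Pair_le prod.collapse)
        also have "\<dots> \<le> (cmod \<rho> * norm x + cmod \<rho> * norm e) + (cmod \<rho> * norm x + cmod \<rho> * norm e)"
        proof -
          have x: "norm (c *\<^sub>R \<tau> *\<^sub>R x) \<le> cmod \<rho> * norm x" if "\<bar>c\<bar> \<le> cmod \<rho>" for c
          proof -
            have "\<bar>c\<bar> * (\<bar>\<tau>\<bar> * norm x) \<le> cmod \<rho> * (1 * norm x)"
              using that \<tau> by (intro mult_mono) auto
            then show ?thesis by (simp add: abs_mult mult.assoc)
          qed
          have e: "norm (c *\<^sub>R e) \<le> cmod \<rho> * norm e" if "\<bar>c\<bar> \<le> cmod \<rho>" for c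
            using mult_right_mono[OF that norm_ge_zero[of e]] by simp
          have "norm (fst w) \<le> norm (Re \<rho> *\<^sub>R \<tau> *\<^sub>R x) + norm (Im \<rho> *\<^sub>R e)"
            unfolding w_def fst_conv by (rule norm_triangle_ineq4)
          moreover have "norm (snd w) \<le> norm (Im \<rho> *\<^sub>R \<tau> *\<^sub>R x) + norm (Re \<rho> *\<^sub>R e)"
            unfolding w_def snd_conv by (rule norm_triangle_ineq)
          ultimately show ?thesis
            using x[OF abs_Re_le_cmod] x[OF abs_Im_le_cmod] e[OF abs_Re_le_cmod] e[OF abs_Im_le_cmod]
            by linarith
        qed
        also have "\<dots> = 2 * (norm x + norm e) / cmod s"
          by (simp add: \<rho>_def norm_divide add_divide_distrib)
        finally have "r * cmod s \<le> 2 * (norm x + norm e)"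
          using False by (simp add: pos_le_divide_eq)
        then show ?thesis using r(1) by (simp add: pos_le_divide_eq mult.commute)
      qed (use r in simp)
      then show ?thesis by (rule that)
    qed
    have "closed ({0..1} - K)"
    proof -
      define C where "C = cball 0 R \<inter> {s. Im s \<ge> 0}"
      have "compact C" unfolding C_def
        by (intro compact_Int_closed compact_cball closed_halfspace_Im_ge)
      then have "compact ((C \<times> {0..1}) \<inter> {w. P (snd w) (fst w) = 0})"
        by (intro compact_Int_closed compact_Times compact_Icc closed_Collect_eq cont continuous_intros)
      then have "compact {w \<in> C \<times> {0..1}. P (snd w) (fst w) = 0}"
        by (simp add: Int_def)
      then have "compact (snd ` {w \<in> C \<times> {0..1}. P (snd w) (fst w) = 0})"
        by (intro compact_continuous_image continuous_intros)
      moreover have "{0..1} - K = snd ` {w \<in> C \<times> {0..1}. P (snd w) (fst w) = 0}"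
      proof (intro set_eqI iffI)
        fix \<tau> assume "\<tau> \<in> {0..1} - K"
        then obtain s where "\<tau> \<in> {0..1}" "Im s > 0" "P \<tau> s = 0" by (auto simp: K_def)
        then have "(s, \<tau>) \<in> {w \<in> C \<times> {0..1}. P (snd w) (fst w) = 0}" 
          using R by (auto simp: C_def)
        then show "\<tau> \<in> snd ` {w \<in> C \<times> {0..1}. P (snd w) (fst w) = 0}" by force
      next
        fix \<tau> assume "\<tau> \<in> snd ` {w \<in> C \<times> {0..1}. P (snd w) (fst w) = 0}"
        then obtain s where s: "Im s \<ge> 0" "\<tau> \<in> {0..1}" "P \<tau> s = 0" by (auto simp: C_def)
        then have "Im s > 0" using real_nz[of s \<tau>] by force
        with s show "\<tau> \<in> {0..1} - K" by (auto simp: K_def)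
      qed
      ultimately show ?thesis using compact_imp_closed by metis
    qed
    moreover have "connected {0..1::real}" by simp
    moreover have "K \<inter> {0..1} \<noteq> {}" using \<open>0 \<in> K\<close> by auto
    ultimately have "({0..1} - K) \<inter> {0..1} = {}"
      using \<open>closed K\<close> connected_closedD[of "{0..1}" K "{0..1} - K"] by blast
    moreover have "(1::real) \<in> {0..1}" by simp
    ultimately have "1 \<in> K" by blast
    then have "P 1 s \<noteq> 0" if "Im s > 0" for s using that by (simp add: K_def)
    then have "P 1 (Complex 0 \<sigma>) \<noteq> 0"
      using real_nz[of "Complex 0 \<sigma>" 1] \<sigma> by (cases "\<sigma> = 0") simp_all
    then show ?thesis by (simp add: P_def)
  qed
  then show ?thesis by (simp add: tube_def)
qed

end

section \<open>Garding's theorem, the hyperbolicity cone and its edge\<close>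

lemma ex_small_multiple:
  fixes x :: "'a::real_normed_vector"
  assumes "\<delta> > 0"
  obtains s where "s > 0" "s * norm x < \<delta>"
proof
  have n: "norm x + 1 > 0" by (simp add: add_nonneg_pos)
  then show "\<delta> / (norm x + 1) > 0" using assms by simp
  have "\<delta> * norm x < \<delta> * (norm x + 1)" using assms by simp
  then show "\<delta> / (norm x + 1) * norm x < \<delta>"
    using n by (simp add: pos_divide_less_eq)
qed

context hyperbolic_polynomial
begin

lemma continuous_on_g [continuous_intros]:
  "continuous_on X u \<Longrightarrow> continuous_on X (\<lambda>x. g (u x))"
  by (rule continuous_on_compose2[of UNIV g])
     (use poly_g in \<open>auto simp: real_polynomial_function_eq intro: continuous_on_polymonial_function\<close>)

definition hyp_cone :: "'a set" where
  "hyp_cone = connected_component_set {x. g x \<noteq> 0} e"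

text \<open>The vectors with positive \<open>e\<close>-eigenvalues. They turn out to form the hyperbolicity cone.\<close>

definition pos_set :: "'a set" where
  "pos_set = {a. \<forall>t\<ge>0. g (a + t *\<^sub>R e) \<noteq> 0}"

text \<open>The ray from \<open>a\<close> in the direction \<open>e\<close> and the segment from \<open>a\<close> to \<open>e\<close> agree up to positive
factors. The segment is compact, which gives openness, and it joins \<open>a\<close> to \<open>e\<close> inside the
set where \<open>g\<close> does not vanish.\<close>

lemma pos_set_iff_segment: "a \<in> pos_set \<longleftrightarrow> (\<forall>u\<in>{0..1}. g ((1 - u) *\<^sub>R a + u *\<^sub>R e) \<noteq> 0)"
proof
  assume a: "a \<in> pos_set"
  show "\<forall>u\<in>{0..1}. g ((1 - u) *\<^sub>R a + u *\<^sub>R e) \<noteq> 0"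
  proof
    fix u :: real assume u: "u \<in> {0..1}"
    show "g ((1 - u) *\<^sub>R a + u *\<^sub>R e) \<noteq> 0"
    proof (cases "u = 1")
      case False
      have "(1 - u) *\<^sub>R a + u *\<^sub>R e = (1 - u) *\<^sub>R (a + (u / (1 - u)) *\<^sub>R e)"
        using False by (simp add: scaleR_add_right)
      moreover have "g (a + (u / (1 - u)) *\<^sub>R e) \<noteq> 0"
        using a u by (simp add: pos_set_def)
      ultimately show ?thesis using False by (simp add: scale_g)
    qed (use g_e_pos in simp)
  qed
next
  assume a: "\<forall>u\<in>{0..1}. g ((1 - u) *\<^sub>R a + u *\<^sub>R e) \<noteq> 0"
  have "g (a + t *\<^sub>R e) \<noteq> 0" if "t \<ge> 0" for t
  proof -
    define u where "u = t / (1 + t)"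
    have u: "u \<in> {0..1}" "(1 + t) * (1 - u) = 1" "(1 + t) * u = t"
      using that by (auto simp: u_def field_simps)
    have "(1 + t) *\<^sub>R ((1 - u) *\<^sub>R a + u *\<^sub>R e) = a + t *\<^sub>R e"
      unfolding scaleR_add_right scaleR_scaleR u by simp
    then show ?thesis using a u(1) that scale_g[of "1 + t" "(1 - u) *\<^sub>R a + u *\<^sub>R e"] by auto
  qed
  then show "a \<in> pos_set" by (simp add: pos_set_def)
qed

lemma open_pos_set: "open pos_set"
proof -
  have "closed {w :: real \<times> 'a. g ((1 - fst w) *\<^sub>R snd w + fst w *\<^sub>R e) = 0}"
    by (intro closed_Collect_eq continuous_intros)
  then have "closed {a. \<exists>u. u \<in> {0..1} \<and> (u, a) \<in> {w :: real \<times> 'a. g ((1 - fst w) *\<^sub>R snd w + fst w *\<^sub>R e) = 0}}"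
    by (intro closed_compact_projection compact_Icc)
  moreover have "- pos_set = {a. \<exists>u. u \<in> {0..1} \<and> (u, a) \<in> {w :: real \<times> 'a. g ((1 - fst w) *\<^sub>R snd w + fst w *\<^sub>R e) = 0}}"
    by (intro set_eqI) (simp add: pos_set_iff_segment Bex_def)
  ultimately show ?thesis by (simp add: open_closed)
qed

lemma pos_set_eigenvalues_pos:
  assumes "a \<in> pos_set" "\<And>t. g (t *\<^sub>R e + a) = g e * (\<Prod>j=1..N. t + lam j)" "j \<in> {1..N}"
  shows "lam j > 0"
proof (rule ccontr)
  assume "\<not> lam j > 0"
  then have "0 \<le> - lam j" by simp
  then have "g (a + (- lam j) *\<^sub>R e) \<noteq> 0" using assms(1) unfolding pos_set_def by blast
  moreover have "g ((- lam j) *\<^sub>R e + a) = 0" unfolding assms(2) using assms(3) by auto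
  ultimately show False by (simp add: add.commute)
qed

text \<open>The second inequality characterises the set by a closed condition among the points where \<open>g\<close> does not
vanish.\<close>

lemma pos_set_mono:
  assumes a: "a \<in> pos_set" "t \<ge> 0"
  shows "0 < g a" "g a \<le> g (a + t *\<^sub>R e)"
proof -
  obtain lam where lam: "\<And>t. g (t *\<^sub>R e + a) = g e * (\<Prod>j=1..N. t + lam j)"
    using hyperbolic_factorization by blast
  have pos: "lam j > 0" if "j \<in> {1..N}" for j
    using pos_set_eigenvalues_pos[OF a(1) lam that] .
  have ga: "g a = g e * (\<Prod>j=1..N. lam j)" using lam[of 0] by simp
  then show "0 < g a" using pos g_e_pos by (auto intro!: mult_pos_pos prod_pos)
  have "(\<Prod>j=1..N. lam j) \<le> (\<Prod>j=1..N. t + lam j)"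
    using pos a(2) by (intro prod_mono) (auto simp: less_imp_le)
  then show "g a \<le> g (a + t *\<^sub>R e)"
    using g_e_pos lam[of t] ga by (simp add: add.commute)
qed

text \<open>The set of positive vectors is connected through segments to \<open>e\<close>, open, and relatively closed in the
set where \<open>g\<close> does not vanish, so it is a component.\<close>

lemma cone_eq_pos_set: "hyp_cone = pos_set"
proof (intro set_eqI iffI)
  fix a assume "a \<in> pos_set"
  then have "closed_segment a e \<subseteq> {x. g x \<noteq> 0}"
    using pos_set_iff_segment by (auto simp: closed_segment_def)
  then show "a \<in> hyp_cone"
    by (auto simp: hyp_cone_def connected_component_def intro!: exI[of _ "closed_segment a e"])
next
  fix a assume "a \<in> hyp_cone"
  then obtain T where T: "connected T" "T \<subseteq> {x. g x \<noteq> 0}" "e \<in> T" "a \<in> T"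
    by (auto simp: hyp_cone_def connected_component_def)
  \<comment> \<open>An open set that contains the points outside \<open>pos_set\<close> where \<open>g\<close> does not vanish.\<close>
  define V where "V = (\<Union>t\<in>{0..}. {x. \<bar>g (x + t *\<^sub>R e)\<bar> < \<bar>g x\<bar>})"
  have "open V" unfolding V_def
    by (intro open_UN ballI open_Collect_less continuous_intros)
  moreover have "pos_set \<inter> V \<inter> T = {}"
  proof -
    have False if x: "x \<in> pos_set" "t \<ge> 0" "\<bar>g (x + t *\<^sub>R e)\<bar> < \<bar>g x\<bar>" for x t
      using pos_set_mono[OF x(1,2)] x(3) by auto
    then show ?thesis by (auto simp: V_def)
  qed
  moreover have "T \<subseteq> pos_set \<union> V"
  proof
    fix x assume "x \<in> T"
    then have "g x \<noteq> 0" using T(2) by auto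
    then show "x \<in> pos_set \<union> V"
      by (force simp: pos_set_def V_def)
  qed
  moreover have "e \<in> pos_set"
  proof -
    have "(1 - u) *\<^sub>R e + u *\<^sub>R e = e" for u by (simp add: algebra_simps)
    then show ?thesis using g_e_pos by (simp add: pos_set_iff_segment)
  qed
  ultimately have "V \<inter> T = {}"
    using connectedD[OF T(1) open_pos_set \<open>open V\<close>] T(3) by blast
  then show "a \<in> pos_set" using \<open>T \<subseteq> pos_set \<union> V\<close> T(4) by blast
qed

lemma cone_iff: "a \<in> hyp_cone \<longleftrightarrow> (\<forall>t\<ge>0. g (a + t *\<^sub>R e) \<noteq> 0)"
  by (simp add: cone_eq_pos_set pos_set_def)

lemma open_cone: "open hyp_cone"
  by (simp add: cone_eq_pos_set open_pos_set)

lemma e_in_cone: "e \<in> hyp_cone"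
  using g_e_pos by (simp add: hyp_cone_def connected_component_refl)

lemma g_pos: "a \<in> hyp_cone \<Longrightarrow> g a > 0"
  using pos_set_mono(1)[of a 0] by (simp add: cone_eq_pos_set)

lemma eigenvalues_pos:
  assumes "a \<in> hyp_cone" "\<And>t. g (t *\<^sub>R e + a) = g e * (\<Prod>j=1..N. t + lam j)" "j \<in> {1..N}"
  shows "lam j > 0"
  using pos_set_eigenvalues_pos assms by (simp add: cone_eq_pos_set)

lemma cone_scaleR:
  assumes "a \<in> hyp_cone" "c > 0"
  shows "c *\<^sub>R a \<in> hyp_cone"
  unfolding cone_iff
proof (intro allI impI)
  fix t :: real assume "t \<ge> 0"
  then have "g (a + (t / c) *\<^sub>R e) \<noteq> 0" using assms by (simp add: cone_iff)
  then show "g (c *\<^sub>R a + t *\<^sub>R e) \<noteq> 0"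
    using scale_g[of c "a + (t / c) *\<^sub>R e"] assms(2) by (simp add: scaleR_add_right)
qed

text \<open>Garding's theorem. The vector \<open>a - \<epsilon> e\<close> still lies in the cone for a small \<open>\<epsilon> > 0\<close>, and adding back
the multiple \<open>\<epsilon> e\<close> puts \<open>a\<close> on a ray to which \<open>ray_in_tube\<close> applies.\<close>

lemma hyperbolic_at:
  assumes a: "a \<in> hyp_cone"
  shows "hyperbolic_polynomial N g a"
proof (rule tube_hyperbolic)
  obtain \<delta> where \<delta>: "\<delta> > 0" "ball a \<delta> \<subseteq> hyp_cone"
    using open_cone a openE by blast
  obtain \<epsilon> where "\<epsilon> > 0" "\<epsilon> * norm e < \<delta>"
    using ex_small_multiple[OF \<delta>(1)] by blast
  then have "a - \<epsilon> *\<^sub>R e \<in> ball a \<delta>" using \<open>\<epsilon> > 0\<close> by (simp add: dist_norm)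
  then have "a - \<epsilon> *\<^sub>R e \<in> hyp_cone" using \<delta>(2) by blast
  then have "e + (1 / \<epsilon>) *\<^sub>R (a - \<epsilon> *\<^sub>R e) \<in> tube"
    using \<open>\<epsilon> > 0\<close> by (intro ray_in_tube) (auto simp: cone_iff)
  then have "\<epsilon> *\<^sub>R (e + (1 / \<epsilon>) *\<^sub>R (a - \<epsilon> *\<^sub>R e)) \<in> tube"
    using \<open>\<epsilon> > 0\<close> by (intro tube_scaleR) auto
  then show "a \<in> tube" using \<open>\<epsilon> > 0\<close> by (simp add: algebra_simps)
qed (rule g_pos[OF a])

text \<open>The cone is a connected component, so it can be based at any of its points. Together with
\<open>hyperbolic_at\<close> this transfers every result about \<open>e\<close> to all points of the cone.\<close>

lemma cone_at:
  assumes "a \<in> hyp_cone"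
  shows "hyperbolic_polynomial.hyp_cone g a = hyp_cone"
proof -
  have "connected_component {x. g x \<noteq> 0} e a" using assms by (simp add: hyp_cone_def)
  from connected_component_eq[of a _ e] this show ?thesis
    by (simp add: hyperbolic_polynomial.hyp_cone_def[OF hyperbolic_at[OF assms]] hyp_cone_def)
qed

lemma cone_iff_at:
  assumes "a \<in> hyp_cone"
  shows "b \<in> hyp_cone \<longleftrightarrow> (\<forall>t\<ge>0. g (b + t *\<^sub>R a) \<noteq> 0)"
  using hyperbolic_polynomial.cone_iff[OF hyperbolic_at[OF assms], of b]
  unfolding cone_at[OF assms] .

lemma factorization:
  assumes "a \<in> hyp_cone"
  obtains lam :: "nat \<Rightarrow> real" where "\<And>t. g (t *\<^sub>R a + x) = g a * (\<Prod>j=1..N. t + lam j)"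
  using hyperbolic_polynomial.hyperbolic_factorization[OF hyperbolic_at[OF assms]] by blast

lemma eigenvalues_pos_at:
  assumes "a \<in> hyp_cone" "x \<in> hyp_cone" "\<And>t. g (t *\<^sub>R a + x) = g a * (\<Prod>j=1..N. t + lam j)" "j \<in> {1..N}"
  shows "lam j > 0"
  using hyperbolic_polynomial.eigenvalues_pos[OF hyperbolic_at[OF assms(1)]] assms
  by (simp add: cone_at)

text \<open>With the cone based at \<open>a\<close>, the ray from \<open>a + b\<close> in the direction \<open>a\<close> is part of the ray from \<open>b\<close>.\<close>

lemma cone_add:
  assumes a: "a \<in> hyp_cone" and b: "b \<in> hyp_cone"
  shows "a + b \<in> hyp_cone"
  unfolding cone_iff_at[OF a]
proof (intro allI impI)
  fix t :: real assume "t \<ge> 0"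
  then have "g (b + (t + 1) *\<^sub>R a) \<noteq> 0" using b cone_iff_at[OF a, of b] by simp
  then show "g (a + b + t *\<^sub>R a) \<noteq> 0" by (simp add: algebra_simps)
qed

lemma convex_cone: "convex hyp_cone"
proof (rule convexI)
  fix x y :: 'a and u v :: real
  assume xy: "x \<in> hyp_cone" "y \<in> hyp_cone" and uv: "0 \<le> u" "0 \<le> v" "u + v = 1"
  show "u *\<^sub>R x + v *\<^sub>R y \<in> hyp_cone"
  proof (cases "u = 0 \<or> v = 0")
    case False
    then show ?thesis using xy uv by (intro cone_add cone_scaleR) auto
  qed (use xy uv in auto)
qed

text \<open>This description of the closure makes its stability under sums and nonnegative multiples, and the
invariance of the cone under the edge, immediate.\<close>

lemma closure_cone_iff: "c \<in> closure hyp_cone \<longleftrightarrow> (\<forall>a\<in>hyp_cone. a + c \<in> hyp_cone)"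
proof (intro iffI ballI)
  fix a assume c: "c \<in> closure hyp_cone" and a: "a \<in> hyp_cone"
  obtain \<delta> where \<delta>: "\<delta> > 0" "ball a \<delta> \<subseteq> hyp_cone" using open_cone a openE by blast
  obtain b where b: "b \<in> hyp_cone" "dist b c < \<delta>"
    using c \<delta>(1) closure_approachable[of c hyp_cone] by blast
  have "a + (c - b) \<in> ball a \<delta>" using b(2) by (simp add: dist_norm norm_minus_commute)
  then have "a + (c - b) \<in> hyp_cone" using \<delta>(2) by blast
  then have "a + (c - b) + b \<in> hyp_cone" using b(1) by (rule cone_add)
  then show "a + c \<in> hyp_cone" by simp
next
  assume c: "\<forall>a\<in>hyp_cone. a + c \<in> hyp_cone"
  show "c \<in> closure hyp_cone" unfolding closure_approachable
  proof (intro allI impI)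
    fix \<delta> :: real assume \<delta>: "\<delta> > 0"
    obtain s where s: "s > 0" "s * norm e < \<delta>"
      using ex_small_multiple[OF \<delta>] by blast
    then have "dist (s *\<^sub>R e + c) c < \<delta>" using s by (simp add: dist_norm)
    moreover have "s *\<^sub>R e + c \<in> hyp_cone" using c cone_scaleR[OF e_in_cone s(1)] by blast
    ultimately show "\<exists>y\<in>hyp_cone. dist y c < \<delta>" by blast
  qed
qed

lemma closure_cone_add: "b \<in> closure hyp_cone \<Longrightarrow> c \<in> closure hyp_cone \<Longrightarrow> b + c \<in> closure hyp_cone"
  unfolding closure_cone_iff by (metis add.assoc)

lemma closure_cone_scaleR:
  assumes "c \<in> closure hyp_cone" "s \<ge> 0"
  shows "s *\<^sub>R c \<in> closure hyp_cone"
  unfolding closure_cone_iff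
proof
  fix a assume a: "a \<in> hyp_cone"
  show "a + s *\<^sub>R c \<in> hyp_cone"
  proof (cases "s = 0")
    case False
    then have "s > 0" using assms by simp
    then have "(1 / s) *\<^sub>R a + c \<in> hyp_cone"
      using assms(1) cone_scaleR[OF a, of "1 / s"] unfolding closure_cone_iff by auto
    then have "s *\<^sub>R ((1 / s) *\<^sub>R a + c) \<in> hyp_cone" using \<open>s > 0\<close> by (rule cone_scaleR)
    then show ?thesis using False by (simp add: scaleR_add_right)
  qed (use a in simp)
qed

text \<open>The edge, the largest linear subspace of the closed cone.\<close>

definition lineality :: "'a set" where
  "lineality = closure hyp_cone \<inter> uminus ` closure hyp_cone"

lemma lineality_iff: "c \<in> lineality \<longleftrightarrow> c \<in> closure hyp_cone \<and> - c \<in> closure hyp_cone"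
  unfolding lineality_def by (auto simp: image_iff) (metis add.inverse_inverse)

lemma subspace_lineality: "subspace lineality"
proof (rule subspaceI)
  show "0 \<in> lineality" by (simp add: lineality_iff closure_cone_iff)
  show "x + y \<in> lineality" if "x \<in> lineality" "y \<in> lineality" for x y
    using that closure_cone_add[of x y] closure_cone_add[of "-x" "-y"]
    by (simp add: lineality_iff)
  show "c *\<^sub>R x \<in> lineality" if "x \<in> lineality" for c x
    using that closure_cone_scaleR[of x "\<bar>c\<bar>"] closure_cone_scaleR[of "- x" "\<bar>c\<bar>"]
    by (cases "c \<ge> 0") (auto simp: lineality_iff)
qed

lemma cone_add_lineality: "a \<in> hyp_cone \<Longrightarrow> c \<in> lineality \<Longrightarrow> a + c \<in> hyp_cone"
  by (simp add: lineality_iff closure_cone_iff)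

text \<open>The right-hand side says that all \<open>a\<close>-eigenvalues of \<open>c\<close> vanish. For \<open>c\<close> in the edge, \<open>t a + c\<close>
and \<open>t a - c\<close> lie in the cone for \<open>t > 0\<close>, so there are neither negative nor positive eigenvalues.
Conversely the whole line \<open>a + s c\<close> avoids the zeros of \<open>g\<close>, and rescaling it exhibits \<open>\<plusminus> c\<close> as
limits of points of the cone.\<close>

lemma lineality_iff_eigenvalues:
  assumes a: "a \<in> hyp_cone"
  shows "c \<in> lineality \<longleftrightarrow> (\<forall>t. g (t *\<^sub>R a + c) = t ^ N * g a)"
proof
  assume c: "c \<in> lineality"
  obtain lam where lam: "\<And>t. g (t *\<^sub>R a + c) = g a * (\<Prod>j=1..N. t + lam j)"
    using factorization[OF a] by blast
  have "lam j = 0" if j: "j \<in> {1..N}" for j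
  proof (rule ccontr)
    assume nz: "lam j \<noteq> 0"
    have "g ((- lam j) *\<^sub>R a + c) = 0" unfolding lam using j by auto
    moreover have "g ((- lam j) *\<^sub>R a + c) \<noteq> 0"
    proof (cases "lam j < 0")
      case True
      then have "(- lam j) *\<^sub>R a + c \<in> hyp_cone"
        using cone_add_lineality[OF cone_scaleR[OF a, of "- lam j"] c] by simp
      then show ?thesis using g_pos by fastforce
    next
      case False
      then have "lam j *\<^sub>R a + - c \<in> hyp_cone"
        using cone_scaleR[OF a, of "lam j"] nz c by (simp add: lineality_iff closure_cone_iff)
      then have "g (lam j *\<^sub>R a + - c) \<noteq> 0" using g_pos by fastforce
      moreover have "(- lam j) *\<^sub>R a + c = (- 1) *\<^sub>R (lam j *\<^sub>R a + - c)" by simp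
      ultimately show ?thesis using scale_g[of "- 1" "lam j *\<^sub>R a + - c"] by simp
    qed
    ultimately show False by simp
  qed
  then have "(\<Prod>j=1..N. t + lam j) = t ^ N" for t by simp
  then show "\<forall>t. g (t *\<^sub>R a + c) = t ^ N * g a" by (simp add: lam)
next
  assume c: "\<forall>t. g (t *\<^sub>R a + c) = t ^ N * g a"
  have line: "a + s *\<^sub>R c \<in> hyp_cone" for s
    unfolding cone_iff_at[OF a]
  proof (intro allI impI)
    fix t :: real assume t: "t \<ge> 0"
    show "g (a + s *\<^sub>R c + t *\<^sub>R a) \<noteq> 0"
    proof (cases "s = 0")
      case True
      then show ?thesis using a t by (simp add: cone_iff_at[OF a])
    next
      case False
      have "a + s *\<^sub>R c + t *\<^sub>R a = s *\<^sub>R (((1 + t) / s) *\<^sub>R a + c)"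
        using False by (simp add: scaleR_add_right scaleR_add_left)
      then show ?thesis using scale_g[of s "((1 + t) / s) *\<^sub>R a + c"] c False t g_pos[OF a] by simp
    qed
  qed
  have "s *\<^sub>R c \<in> closure hyp_cone" for s
    unfolding closure_approachable
  proof (intro allI impI)
    fix \<delta> :: real assume \<delta>: "\<delta> > 0"
    obtain r where r: "r > 0" "r * norm a < \<delta>"
      using ex_small_multiple[OF \<delta>] by blast
    have "r *\<^sub>R (a + (s / r) *\<^sub>R c) = r *\<^sub>R a + s *\<^sub>R c"
      using r by (simp add: scaleR_add_right)
    then have "dist (r *\<^sub>R (a + (s / r) *\<^sub>R c)) (s *\<^sub>R c) < \<delta>"
      using r by (simp add: dist_norm)
    then show "\<exists>y\<in>hyp_cone. dist y (s *\<^sub>R c) < \<delta>"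
      using cone_scaleR[OF line r(1)] by blast
  qed
  from this[of 1] this[of "- 1"] show "c \<in> lineality" by (simp add: lineality_iff)
qed

lemma g_add_lineality:
  assumes "a \<in> hyp_cone" "c \<in> lineality"
  shows "g (a + c) = g a"
proof -
  have "g (1 *\<^sub>R a + c) = 1 ^ N * g a" using assms lineality_iff_eigenvalues by blast
  then show ?thesis by simp
qed

lemma g_line:
  assumes lam: "\<And>t. g (t *\<^sub>R a + x) = g a * (\<Prod>j=1..N. t + lam j)"
  shows "g (a + s *\<^sub>R x) = g a * (\<Prod>j=1..N. 1 + s * lam j)"
proof (cases "s = 0")
  case False
  have "g (a + s *\<^sub>R x) = g (s *\<^sub>R ((1 / s) *\<^sub>R a + x))"
    using False by (simp add: scaleR_add_right)
  also have "\<dots> = g a * (s ^ N * (\<Prod>j=1..N. 1 / s + lam j))"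
    unfolding scale_g lam by simp
  also have "s ^ N * (\<Prod>j=1..N. 1 / s + lam j) = (\<Prod>j=1..N. s * (1 / s + lam j))"
    by (simp add: prod.distrib)
  also have "\<dots> = (\<Prod>j=1..N. 1 + s * lam j)"
    using False by (intro prod.cong) (auto simp: distrib_left)
  finally show ?thesis .
qed simp

end

section \<open>Smooth functions and their inverses\<close>

lemma frechet_derivative_eq:
  "(f has_derivative f') (at x) \<Longrightarrow> frechet_derivative f (at x) = f'"
  by (rule frechet_derivative_at[symmetric])

lemma has_derivative_frechet:
  "f differentiable (at x) \<Longrightarrow> (f has_derivative frechet_derivative f (at x)) (at x)"
  by (simp add: frechet_derivative_works)

lemma frechet_derivative_cong_open:
  assumes "open U" "x \<in> U" "\<And>y. y \<in> U \<Longrightarrow> f y = h y" "h differentiable (at x)"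
  shows "f differentiable (at x)" "frechet_derivative f (at x) = frechet_derivative h (at x)"
proof -
  have *: "(f has_derivative frechet_derivative h (at x)) (at x)"
    by (rule has_derivative_transform_within_open[OF has_derivative_frechet[OF assms(4)] assms(1,2)])
       (simp add: assms(3))
  then show "f differentiable (at x)" by (rule differentiableI)
  show "frechet_derivative f (at x) = frechet_derivative h (at x)"
    by (rule frechet_derivative_eq[OF *])
qed

text \<open>Smoothness is proved algebraically: a family of functions that is stable under directional
derivatives consists of smooth functions, so it suffices to exhibit such a family. Agreement is
required on \<open>U\<close> only, because derivatives carry no information elsewhere.\<close>

definition derivation_closed :: "'a::euclidean_space set \<Rightarrow> ('a \<Rightarrow> real) set \<Rightarrow> bool" where
  "derivation_closed U R \<longleftrightarrow>
     (\<forall>r\<in>R. (\<forall>x\<in>U. r differentiable (at x)) \<and>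
       (\<forall>v. \<exists>r'\<in>R. \<forall>x\<in>U. frechet_derivative r (at x) v = r' x))"

lemma derivation_closedD:
  assumes "derivation_closed U R" "r \<in> R"
  shows "x \<in> U \<Longrightarrow> r differentiable (at x)"
    and "\<exists>r'\<in>R. \<forall>x\<in>U. frechet_derivative r (at x) v = r' x"
  using assms by (simp_all add: derivation_closed_def)

lemma smooth_on_open_if_derivation_closed:
  fixes f :: "'a::euclidean_space \<Rightarrow> 'b::euclidean_space"
  assumes U: "open U" and R: "derivation_closed U R"
    and f: "\<And>b. b \<in> Basis \<Longrightarrow> \<exists>r\<in>R. \<forall>x\<in>U. f x \<bullet> b = r x"
  shows "smooth_on_open f U"
proof -
  have comp: "(\<lambda>x. f x \<bullet> b) differentiable (at x)"
      "frechet_derivative (\<lambda>x. f x \<bullet> b) (at x) = frechet_derivative r (at x)"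
    if "r \<in> R" "\<forall>x\<in>U. f x \<bullet> b = r x" "x \<in> U" for r b x and f :: "'a \<Rightarrow> 'b"
    using frechet_derivative_cong_open[OF U that(3), of "\<lambda>x. f x \<bullet> b" r]
      derivation_closedD(1)[OF R that(1,3)] that(2) by auto
  have diff: "f differentiable (at x)"
    if f: "\<And>b. b \<in> Basis \<Longrightarrow> \<exists>r\<in>R. \<forall>x\<in>U. f x \<bullet> b = r x" and x: "x \<in> U" for f :: "'a \<Rightarrow> 'b" and x
    unfolding differentiable_componentwise_within[of f x UNIV]
  proof
    fix b :: 'b assume "b \<in> Basis"
    then obtain r where r: "r \<in> R" "\<forall>x\<in>U. f x \<bullet> b = r x" using f by blast
    show "(\<lambda>x. f x \<bullet> b) differentiable (at x)" by (rule comp(1)[OF r x])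
  qed
  have "Ck_on k f U" for k using f
  proof (induction k arbitrary: f)
    case 0
    then show ?case
      using diff[OF 0] by (auto intro!: continuous_at_imp_continuous_on differentiable_imp_continuous_within)
  next
    case (Suc k)
    have "Ck_on k (\<lambda>x. frechet_derivative f (at x) v) U" for v
    proof (rule Suc.IH)
      fix b :: 'b assume "b \<in> Basis"
      then obtain r where r: "r \<in> R" "\<forall>x\<in>U. f x \<bullet> b = r x" using Suc.prems by blast
      obtain r' where r': "r' \<in> R" "\<forall>x\<in>U. frechet_derivative r (at x) v = r' x"
        using derivation_closedD(2)[OF R r(1)] by blast
      have "frechet_derivative f (at x) v \<bullet> b = r' x" if x: "x \<in> U" for x
      proof -
        have "((\<lambda>x. f x \<bullet> b) has_derivative (\<lambda>h. frechet_derivative f (at x) h \<bullet> b)) (at x)"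
          by (intro has_derivative_inner_left has_derivative_frechet diff[OF Suc.prems] x)
        from frechet_derivative_eq[OF this] comp(2)[OF r x]
        have "(\<lambda>h. frechet_derivative f (at x) h \<bullet> b) = frechet_derivative r (at x)" by simp
        from fun_cong[OF this, of v] show ?thesis using r'(2) x by simp
      qed
      with r'(1) show "\<exists>r\<in>R. \<forall>x\<in>U. frechet_derivative f (at x) v \<bullet> b = r x" by (intro bexI[of _ r']) auto
    qed
    with diff[OF Suc.prems] show ?case by simp
  qed
  then show ?thesis by (simp add: smooth_on_open_def)
qed

inductive_set function_algebra :: "('a \<Rightarrow> real) set \<Rightarrow> ('a \<Rightarrow> real) set" for A where
  gen: "f \<in> A \<Longrightarrow> f \<in> function_algebra A"
| const: "(\<lambda>x. c) \<in> function_algebra A"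
| add: "f \<in> function_algebra A \<Longrightarrow> h \<in> function_algebra A \<Longrightarrow> (\<lambda>x. f x + h x) \<in> function_algebra A"
| mult: "f \<in> function_algebra A \<Longrightarrow> h \<in> function_algebra A \<Longrightarrow> (\<lambda>x. f x * h x) \<in> function_algebra A"

lemma func_algebra_sum:
  "(\<And>i. i \<in> I \<Longrightarrow> f i \<in> function_algebra A) \<Longrightarrow> (\<lambda>x. \<Sum>i\<in>I. f i x) \<in> function_algebra A"
  by (induction I rule: infinite_finite_induct) (auto intro: function_algebra.intros)

lemma func_algebra_uminus:
  assumes "f \<in> function_algebra A"
  shows "(\<lambda>x. - f x) \<in> function_algebra A"
  using function_algebra.mult[OF function_algebra.const[of "- 1"] assms] by simp

lemma derivation_closed_func_algebra:
  assumes "\<And>r x. r \<in> A \<Longrightarrow> x \<in> U \<Longrightarrow> r differentiable (at x)"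
    and "\<And>r v. r \<in> A \<Longrightarrow> \<exists>r'\<in>function_algebra A. \<forall>x\<in>U. frechet_derivative r (at x) v = r' x"
  shows "derivation_closed U (function_algebra A)"
proof -
  have "(\<forall>x\<in>U. r differentiable (at x)) \<and>
      (\<forall>v. \<exists>r'\<in>function_algebra A. \<forall>x\<in>U. frechet_derivative r (at x) v = r' x)"
    if "r \<in> function_algebra A" for r
    using that
  proof induction
    case (gen f)
    then show ?case using assms by blast
  next
    case (const c)
    show ?case by (auto intro!: bexI[of _ "\<lambda>x. 0"] function_algebra.const)
  next
    case (add f h)
    have "\<exists>r'\<in>function_algebra A. \<forall>x\<in>U. frechet_derivative (\<lambda>x. f x + h x) (at x) v = r' x" for v
    proof -
      obtain f' h' where *: "f' \<in> function_algebra A" "\<forall>x\<in>U. frechet_derivative f (at x) v = f' x"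
        "h' \<in> function_algebra A" "\<forall>x\<in>U. frechet_derivative h (at x) v = h' x"
        using add.IH by meson
      have "frechet_derivative (\<lambda>x. f x + h x) (at x) v = f' x + h' x" if "x \<in> U" for x
      proof -
        have "((\<lambda>x. f x + h x) has_derivative
            (\<lambda>k. frechet_derivative f (at x) k + frechet_derivative h (at x) k)) (at x)"
          using add.IH that by (intro has_derivative_add has_derivative_frechet) auto
        from frechet_derivative_eq[OF this] show ?thesis using * that by simp
      qed
      then show ?thesis by (intro bexI[OF _ function_algebra.add[OF *(1,3)]] ballI)
    qed
    then show ?case using add.IH by auto
  next
    case (mult f h)
    have "\<exists>r'\<in>function_algebra A. \<forall>x\<in>U. frechet_derivative (\<lambda>x. f x * h x) (at x) v = r' x" for v
    proof -
      obtain f' h' where *: "f' \<in> function_algebra A" "\<forall>x\<in>U. frechet_derivative f (at x) v = f' x"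
        "h' \<in> function_algebra A" "\<forall>x\<in>U. frechet_derivative h (at x) v = h' x"
        using mult.IH by meson
      have "frechet_derivative (\<lambda>x. f x * h x) (at x) v = f x * h' x + f' x * h x" if "x \<in> U" for x
      proof -
        have "((\<lambda>x. f x * h x) has_derivative
            (\<lambda>k. f x * frechet_derivative h (at x) k + frechet_derivative f (at x) k * h x)) (at x)"
          using mult.IH that by (intro has_derivative_mult has_derivative_frechet) auto
        from frechet_derivative_eq[OF this] show ?thesis using * that by simp
      qed
      moreover have "(\<lambda>x. f x * h' x + f' x * h x) \<in> function_algebra A"
        using * mult.hyps by (intro function_algebra.add function_algebra.mult)
      ultimately show ?thesis by (intro bexI[of _ "\<lambda>x. f x * h' x + f' x * h x"] ballI)
    qed
    then show ?case using mult.IH by auto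
  qed
  then show ?thesis by (simp add: derivation_closed_def)
qed

lemma Ck_on_cong:
  fixes f h :: "'a::euclidean_space \<Rightarrow> 'b::real_normed_vector"
  assumes "open U" "\<And>x. x \<in> U \<Longrightarrow> f x = h x"
  shows "Ck_on k f U \<longleftrightarrow> Ck_on k h U"
  using assms(2)
proof (induction k arbitrary: f h)
  case 0
  then show ?case by (simp cong: continuous_on_cong)
next
  case (Suc k)
  have one: "Ck_on (Suc k) h U" if *: "Ck_on (Suc k) f U" "\<And>x. x \<in> U \<Longrightarrow> f x = h x"
    for f h :: "'a \<Rightarrow> 'b"
  proof -
    have d: "h differentiable (at x)" "frechet_derivative h (at x) = frechet_derivative f (at x)"
      if "x \<in> U" for x
      using frechet_derivative_cong_open[OF assms(1) that, of h f] * that by auto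
    have "Ck_on k (\<lambda>x. frechet_derivative h (at x) v) U" for v
      using Suc.IH[of "\<lambda>x. frechet_derivative f (at x) v" "\<lambda>x. frechet_derivative h (at x) v"] * d by auto
    then show ?thesis using d by simp
  qed
  show ?case using one[of f h] one[of h f] Suc.prems by metis
qed

lemma Ck_on_inner:
  fixes f :: "'a::euclidean_space \<Rightarrow> 'b::euclidean_space"
  assumes "open U" "Ck_on k f U"
  shows "Ck_on k (\<lambda>x. f x \<bullet> b) U"
  using assms(2)
proof (induction k arbitrary: f)
  case 0
  then show ?case by (auto intro: continuous_intros)
next
  case (Suc k)
  have d: "((\<lambda>x. f x \<bullet> b) has_derivative (\<lambda>h. frechet_derivative f (at x) h \<bullet> b)) (at x)" if "x \<in> U" for x
    using Suc.prems that by (intro has_derivative_inner_left has_derivative_frechet) auto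
  have "Ck_on k (\<lambda>x. frechet_derivative (\<lambda>x. f x \<bullet> b) (at x) v) U" for v
  proof (subst Ck_on_cong[OF assms(1)])
    show "frechet_derivative (\<lambda>x. f x \<bullet> b) (at x) v = frechet_derivative f (at x) v \<bullet> b" if "x \<in> U" for x
      using frechet_derivative_eq[OF d[OF that]] by simp
    show "Ck_on k (\<lambda>x. frechet_derivative f (at x) v \<bullet> b) U"
      using Suc.prems by (intro Suc.IH) simp
  qed
  moreover have "(\<lambda>x. f x \<bullet> b) differentiable (at x)" if "x \<in> U" for x
    using d[OF that] by (rule differentiableI)
  ultimately show ?case by simp
qed

lemma smooth_on_open_inner:
  fixes f :: "'a::euclidean_space \<Rightarrow> 'b::euclidean_space"
  assumes "open U" "smooth_on_open f U"
  shows "smooth_on_open (\<lambda>x. f x \<bullet> b) U"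
  using assms(2) unfolding smooth_on_open_def by (blast intro: Ck_on_inner[OF assms(1)])

lemma smooth_on_openD:
  assumes "smooth_on_open f U"
  shows "x \<in> U \<Longrightarrow> f differentiable (at x)" "continuous_on U f"
    "smooth_on_open (\<lambda>x. frechet_derivative f (at x) v) U"
proof -
  have *: "Ck_on k f U" for k using assms by (simp add: smooth_on_open_def)
  show "x \<in> U \<Longrightarrow> f differentiable (at x)" "continuous_on U f" using *[of "Suc 0"] *[of 0] by auto
  show "smooth_on_open (\<lambda>x. frechet_derivative f (at x) v) U"
    unfolding smooth_on_open_def
  proof
    show "Ck_on k (\<lambda>x. frechet_derivative f (at x) v) U" for k using *[of "Suc k"] by simp
  qed
qed

text \<open>The usual formula \<open>D (L\<^sup>-\<^sup>1) = - L\<^sup>-\<^sup>1 (D L) L\<^sup>-\<^sup>1\<close>. The map \<open>(x, u) \<mapsto> (x, L x u)\<close> is injective and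
differentiable with invertible derivative, so its inverse \<open>(x, w) \<mapsto> (x, L x\<^sup>-\<^sup>1 w)\<close> is differentiable
as well.\<close>

lemma has_derivative_inverse_linear_family:
  fixes L :: "'a::euclidean_space \<Rightarrow> 'b::euclidean_space \<Rightarrow> 'b"
  assumes U: "open U" "x0 \<in> U"
    and lin: "\<And>x. x \<in> U \<Longrightarrow> linear (L x)" and inj: "\<And>x. x \<in> U \<Longrightarrow> inj (L x)"
    and diff: "\<And>x b. x \<in> U \<Longrightarrow> (\<lambda>x. L x b) differentiable (at x)"
  shows "((\<lambda>x. inv (L x) v) has_derivative
      (\<lambda>h. - inv (L x0) (\<Sum>c\<in>Basis. (inv (L x0) v \<bullet> c) *\<^sub>R frechet_derivative (\<lambda>x. L x c) (at x0) h))) (at x0)"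
proof -
  define \<Theta> where "\<Theta> = (\<lambda>(x, u). (x, L x u))"
  define \<Omega> where "\<Omega> = (\<lambda>(x, w). (x, inv (L x) w))"
  define u0 where "u0 = inv (L x0) v"
  define D where "D h = (\<Sum>c\<in>Basis. (u0 \<bullet> c) *\<^sub>R frechet_derivative (\<lambda>x. L x c) (at x0) h)" for h
  have surj: "surj (L x)" if "x \<in> U" for x
    using linear_injective_imp_surjective[OF lin inj] that by blast
  \<comment> \<open>In coordinates the joint dependence on \<open>x\<close> and \<open>u\<close> is visibly differentiable.\<close>
  have Lu: "L x u = (\<Sum>c\<in>Basis. (u \<bullet> c) *\<^sub>R L x c)" if "x \<in> U" for x u
    by (subst euclidean_representation[of u, symmetric])
       (simp add: linear_sum[OF lin[OF that]] linear_cmul[OF lin[OF that]])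
  have inv_lin: "linear (inv (L x0))"
    by (intro inj_linear_imp_inv_linear lin inj U)
  have \<Theta>_sum: "\<Theta> p = (fst p, \<Sum>c\<in>Basis. (snd p \<bullet> c) *\<^sub>R L (fst p) c)" if "p \<in> U \<times> UNIV" for p
    using that Lu[of "fst p" "snd p"] by (simp add: \<Theta>_def case_prod_beta mem_Times_iff)
  have comp: "((\<lambda>p. L (fst p) c) has_derivative (\<lambda>q. frechet_derivative (\<lambda>x. L x c) (at (fst p)) (fst q))) (at p)"
    if "p \<in> U \<times> UNIV" for p :: "'a \<times> 'b" and c
  proof -
    have "((\<lambda>x. L x c) has_derivative frechet_derivative (\<lambda>x. L x c) (at (fst p))) (at (fst p))"
      using that by (intro has_derivative_frechet diff) auto
    from has_derivative_compose[OF has_derivative_fst[OF has_derivative_ident] this]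
    show ?thesis .
  qed
  have der_sum: "((\<lambda>p. (fst p, \<Sum>c\<in>Basis. (snd p \<bullet> c) *\<^sub>R L (fst p) c)) has_derivative
     (\<lambda>q. (fst q, \<Sum>c\<in>Basis. (snd p \<bullet> c) *\<^sub>R frechet_derivative (\<lambda>x. L x c) (at (fst p)) (fst q)
        + (snd q \<bullet> c) *\<^sub>R L (fst p) c))) (at p)" if "p \<in> U \<times> UNIV" for p
    by (intro has_derivative_Pair has_derivative_fst has_derivative_sum has_derivative_scaleR
        has_derivative_inner_left has_derivative_snd has_derivative_ident comp that)
  have der: "(\<Theta> has_derivative (\<lambda>(h, k). (h, D h + L x0 k))) (at (x0, u0))"
  proof -
    have "(\<lambda>(h, k). (h, D h + L x0 k)) = (\<lambda>q. (fst q, \<Sum>c\<in>Basis.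
        (u0 \<bullet> c) *\<^sub>R frechet_derivative (\<lambda>x. L x c) (at x0) (fst q) + (snd q \<bullet> c) *\<^sub>R L x0 c))"
    proof
      fix q
      show "(case q of (h, k) \<Rightarrow> (h, D h + L x0 k)) = (fst q, \<Sum>c\<in>Basis.
          (u0 \<bullet> c) *\<^sub>R frechet_derivative (\<lambda>x. L x c) (at x0) (fst q) + (snd q \<bullet> c) *\<^sub>R L x0 c)"
        unfolding sum.distrib D_def by (simp add: Lu[OF U(2), of "snd q"] case_prod_beta)
    qed
    then have "((\<lambda>p. (fst p, \<Sum>c\<in>Basis. (snd p \<bullet> c) *\<^sub>R L (fst p) c)) has_derivative
        (\<lambda>(h, k). (h, D h + L x0 k))) (at (x0, u0))"
      using der_sum[of "(x0, u0)"] U(2) by simp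
    then show ?thesis
    proof (rule has_derivative_transform_within_open)
      show "open (U \<times> (UNIV :: 'b set))" using U by (intro open_Times) auto
    qed (use U \<Theta>_sum in auto)
  qed
  have "(\<Omega> has_derivative (\<lambda>(h, w). (h, inv (L x0) (w - D h)))) (at (\<Theta> (x0, u0)))"
  proof (rule has_derivative_inverse_strong[of "U \<times> UNIV" "(x0, u0)" \<Theta> \<Omega>])
    show "open (U \<times> (UNIV :: 'b set))" using U by (intro open_Times) auto
    have "continuous_on (U \<times> UNIV) (\<lambda>p. (fst p, \<Sum>c\<in>Basis. (snd p \<bullet> c) *\<^sub>R L (fst p) c))"
      using der_sum by (intro continuous_at_imp_continuous_on ballI) (rule has_derivative_continuous)
    then show "continuous_on (U \<times> UNIV) \<Theta>"
      by (rule continuous_on_eq) (simp add: \<Theta>_sum)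
    show "\<Omega> (\<Theta> p) = p" if "p \<in> U \<times> UNIV" for p
      using that inj by (auto simp: \<Omega>_def \<Theta>_def inv_f_f)
    show "(\<Theta> has_derivative (\<lambda>(h, k). (h, D h + L x0 k))) (at (x0, u0))"
      by (rule der)
    show "(\<lambda>(h, k). (h, D h + L x0 k)) \<circ> (\<lambda>(h, w). (h, inv (L x0) (w - D h))) = id"
      using surj[OF U(2)] by (auto simp: fun_eq_iff surj_f_inv_f)
  qed (use U in auto)
  moreover have "\<Theta> (x0, u0) = (x0, v)"
    using surj[OF U(2)] by (simp add: \<Theta>_def u0_def surj_f_inv_f)
  ultimately have "(\<Omega> has_derivative (\<lambda>(h, w). (h, inv (L x0) (w - D h)))) (at (x0, v))" by simp
  moreover have "((\<lambda>x. (x, v)) has_derivative (\<lambda>h. (h, 0))) (at x0)"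
    by (intro derivative_intros)
  ultimately have "((\<lambda>x. snd (\<Omega> (x, v))) has_derivative
      (\<lambda>h. snd ((\<lambda>(h, w). (h, inv (L x0) (w - D h))) (h, 0)))) (at x0)"
    by (intro has_derivative_snd has_derivative_compose[of "\<lambda>x. (x, v)" "\<lambda>h. (h, 0)" x0 UNIV \<Omega>])
  then show ?thesis
    by (simp add: \<Omega>_def D_def u0_def linear_neg[OF inv_lin])
qed

text \<open>The inverse \<open>\<Psi>\<close> has derivative \<open>(D f)\<^sup>-\<^sup>1 \<circ> \<Psi>\<close>. The algebra generated by the smooth
functions on \<open>U\<close>, the coordinates and the matrix entries \<open>m\<close> of \<open>(D f)\<^sup>-\<^sup>1\<close> is stable under
derivatives by the formula for the derivative of an inverse. By the chain rule, so is the
set of its composites with \<open>\<Psi>\<close>, which contains the coordinates of \<open>\<Psi>\<close>.\<close>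

theorem smooth_inverse:
  fixes f :: "'a::euclidean_space \<Rightarrow> 'a"
  assumes U: "open U" and f: "smooth_on_open f U" and inj_f: "inj_on f U"
    and inj: "\<And>x. x \<in> U \<Longrightarrow> inj (frechet_derivative f (at x))"
  shows "open (f ` U)" "smooth_on_open (inv_into U f) (f ` U)"
proof -
  define L where "L x = frechet_derivative f (at x)" for x
  define \<Psi> where "\<Psi> = inv_into U f"
  define m where "m b v x = inv (L x) v \<bullet> b" for b v x
  define A where "A = {r. smooth_on_open r U} \<union> range (\<lambda>b x. x \<bullet> b) \<union> (\<Union>b. range (m b))"
  show openW: "open (f ` U)"
    using invariance_of_domain[OF smooth_on_openD(2)[OF f] U inj_f] .
  have \<Psi>: "\<Psi> y \<in> U" "f (\<Psi> y) = y" if "y \<in> f ` U" for y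
    using that by (simp_all add: \<Psi>_def inv_into_into f_inv_into_f)
  have derf: "(f has_derivative L x) (at x)" if "x \<in> U" for x
    unfolding L_def by (intro has_derivative_frechet smooth_on_openD(1)[OF f] that)
  have lin: "linear (L x)" if "x \<in> U" for x
    using has_derivative_linear[OF derf[OF that]] .
  have inj_L: "inj (L x)" if "x \<in> U" for x using inj[OF that] by (simp add: L_def)
  have inv_lin: "linear (inv (L x))" if "x \<in> U" for x
    by (intro inj_linear_imp_inv_linear lin inj_L that)
  have L_inv: "L x \<circ> inv (L x) = id" if "x \<in> U" for x
    using linear_injective_imp_surjective[OF lin inj_L] that by (simp add: surj_iff)
  have der\<Psi>: "(\<Psi> has_derivative inv (L (\<Psi> y))) (at y)" if y: "y \<in> f ` U" for y
  proof -
    have "(\<Psi> has_derivative inv (L (\<Psi> y))) (at (f (\<Psi> y)))"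
    proof (rule has_derivative_inverse_strong[of U "\<Psi> y" f \<Psi> "L (\<Psi> y)"])
      show "\<Psi> (f x) = x" if "x \<in> U" for x using inj_f that by (simp add: \<Psi>_def)
    qed (use U derf L_inv smooth_on_openD(2)[OF f] \<Psi>(1)[OF y] in simp_all)
    then show ?thesis by (simp add: \<Psi>(2)[OF y])
  qed
  have sm: "smooth_on_open (\<lambda>x. L x c) U" for c
    unfolding L_def by (rule smooth_on_openD(3)[OF f])
  have inv_expand: "inv (L x) w \<bullet> b = (\<Sum>d\<in>Basis. (w \<bullet> d) * m b d x)" if "x \<in> U" for x w b
  proof -
    have "inv (L x) w = (\<Sum>d\<in>Basis. (w \<bullet> d) *\<^sub>R inv (L x) d)"
      by (subst euclidean_representation[of w, symmetric])
         (simp only: linear_sum[OF inv_lin[OF that]] linear_cmul[OF inv_lin[OF that]])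
    then show ?thesis by (simp add: m_def inner_sum_left)
  qed
  have m_alg: "m b v \<in> function_algebra A" for b v
    by (rule function_algebra.gen) (auto simp: A_def)
  have closed: "derivation_closed U (function_algebra A)"
  proof (rule derivation_closed_func_algebra)
    fix r x assume "r \<in> A" "x \<in> U"
    then consider "smooth_on_open r U" | b where "r = (\<lambda>x. x \<bullet> b)" | b v where "r = m b v"
      by (auto simp: A_def)
    then show "r differentiable (at x)"
    proof cases
      case 1
      then show ?thesis using \<open>x \<in> U\<close> smooth_on_openD(1) by blast
    next
      case 2
      have "((\<lambda>x. x \<bullet> b) has_derivative (\<lambda>h. h \<bullet> b)) (at x)"
        by (intro has_derivative_inner_left has_derivative_ident)
      then show ?thesis unfolding 2 by (rule differentiableI)
    next
      case 3
      have "((\<lambda>x. inv (L x) v) has_derivative (\<lambda>h. - inv (L x)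
          (\<Sum>c\<in>Basis. (inv (L x) v \<bullet> c) *\<^sub>R frechet_derivative (\<lambda>x. L x c) (at x) h))) (at x)"
        by (intro has_derivative_inverse_linear_family[OF U \<open>x \<in> U\<close>] lin inj_L smooth_on_openD(1)[OF sm])
      from differentiableI[OF has_derivative_inner_left[OF this, of b]]
      show ?thesis unfolding 3 m_def .
    qed
  next
    fix r v assume "r \<in> A"
    then consider "smooth_on_open r U" | b where "r = (\<lambda>x. x \<bullet> b)" | b w where "r = m b w"
      by (auto simp: A_def)
    then show "\<exists>r'\<in>function_algebra A. \<forall>x\<in>U. frechet_derivative r (at x) v = r' x"
    proof cases
      case 1
      have "(\<lambda>x. frechet_derivative r (at x) v) \<in> function_algebra A"
        using smooth_on_openD(3)[OF 1] by (intro function_algebra.gen) (simp add: A_def)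
      then show ?thesis by (rule bexI[rotated]) simp
    next
      case 2
      have "frechet_derivative r (at x) v = v \<bullet> b" for x
        unfolding 2 by (subst frechet_derivative_eq[OF has_derivative_inner_left[OF has_derivative_ident]]) simp
      then show ?thesis by (intro bexI[OF _ function_algebra.const[of "v \<bullet> b"]]) simp
    next
      case 3
      define K where "K c d x = frechet_derivative (\<lambda>x. L x c) (at x) v \<bullet> d" for c d x
      have "K c d \<in> function_algebra A" for c d
      proof (rule function_algebra.gen)
        show "K c d \<in> A"
          unfolding K_def A_def using smooth_on_open_inner[OF U smooth_on_openD(3)[OF sm]] by simp
      qed
      then have "(\<lambda>x. - (\<Sum>d\<in>Basis. (\<Sum>c\<in>Basis. m c w x * K c d x) * m b d x)) \<in> function_algebra A"
        using m_alg by (intro func_algebra_uminus func_algebra_sum function_algebra.mult)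
      moreover have "frechet_derivative r (at x) v =
          - (\<Sum>d\<in>Basis. (\<Sum>c\<in>Basis. m c w x * K c d x) * m b d x)" if x: "x \<in> U" for x
      proof -
        have "((\<lambda>x. inv (L x) w) has_derivative (\<lambda>h. - inv (L x)
            (\<Sum>c\<in>Basis. (inv (L x) w \<bullet> c) *\<^sub>R frechet_derivative (\<lambda>x. L x c) (at x) h))) (at x)"
          by (intro has_derivative_inverse_linear_family[OF U x] lin inj_L smooth_on_openD(1)[OF sm])
        from frechet_derivative_eq[OF has_derivative_inner_left[OF this, of b]]
        have "frechet_derivative r (at x) v = - inv (L x)
            (\<Sum>c\<in>Basis. (inv (L x) w \<bullet> c) *\<^sub>R frechet_derivative (\<lambda>x. L x c) (at x) v) \<bullet> b"
          unfolding 3 m_def by simp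
        then show ?thesis
          unfolding inner_minus_left
          by (simp add: inv_expand[OF x, of "\<Sum>c\<in>Basis. (inv (L x) w \<bullet> c) *\<^sub>R frechet_derivative (\<lambda>x. L x c) (at x) v"]
              K_def m_def inner_sum_left)
      qed
      ultimately show ?thesis
        by (intro bexI[of _ "\<lambda>x. - (\<Sum>d\<in>Basis. (\<Sum>c\<in>Basis. m c w x * K c d x) * m b d x)"] ballI)
    qed
  qed
  have closed': "derivation_closed (f ` U) ((\<lambda>r y. r (\<Psi> y)) ` function_algebra A)"
    unfolding derivation_closed_def
  proof (intro ballI conjI allI)
    fix q assume "q \<in> (\<lambda>r y. r (\<Psi> y)) ` function_algebra A"
    then obtain r where r: "r \<in> function_algebra A" "q = (\<lambda>y. r (\<Psi> y))" by auto
    have der: "(q has_derivative (\<lambda>h. frechet_derivative r (at (\<Psi> y)) (inv (L (\<Psi> y)) h))) (at y)"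
      if y: "y \<in> f ` U" for y
      unfolding r(2)
    proof (rule has_derivative_compose[OF der\<Psi>[OF y]])
      show "(r has_derivative frechet_derivative r (at (\<Psi> y))) (at (\<Psi> y))"
        using closed r(1) \<Psi>(1)[OF y] unfolding derivation_closed_def
        by (blast intro: has_derivative_frechet)
    qed
    show "q differentiable (at y)" if "y \<in> f ` U" for y using der[OF that] by (rule differentiableI)
    fix v
    obtain r' where r': "\<And>b. r' b \<in> function_algebra A"
        "\<And>b x. x \<in> U \<Longrightarrow> frechet_derivative r (at x) b = r' b x"
      using closed r(1) unfolding derivation_closed_def by metis
    have alg: "(\<lambda>x. \<Sum>b\<in>Basis. m b v x * r' b x) \<in> function_algebra A"
      by (intro func_algebra_sum function_algebra.mult m_alg r')
    have "frechet_derivative q (at y) v = (\<Sum>b\<in>Basis. m b v (\<Psi> y) * r' b (\<Psi> y))" if y: "y \<in> f ` U" for y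
    proof -
      have "linear (frechet_derivative r (at (\<Psi> y)))"
        using closed r(1) \<Psi>(1)[OF y] unfolding derivation_closed_def
        by (blast intro: linear_frechet_derivative)
      then have "frechet_derivative r (at (\<Psi> y)) (\<Sum>b\<in>Basis. (w \<bullet> b) *\<^sub>R b) =
          (\<Sum>b\<in>Basis. (w \<bullet> b) * frechet_derivative r (at (\<Psi> y)) b)" for w
        by (simp add: linear_sum linear_cmul)
      from this[of "inv (L (\<Psi> y)) v", unfolded euclidean_representation] show ?thesis
        by (simp only: frechet_derivative_eq[OF der[OF y]] r'(2)[OF \<Psi>(1)[OF y]] m_def)
    qed
    then show "\<exists>q'\<in>(\<lambda>r y. r (\<Psi> y)) ` function_algebra A. \<forall>y\<in>f ` U. frechet_derivative q (at y) v = q' y"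
      by (intro bexI[OF _ imageI[OF alg]] ballI)
  qed
  show "smooth_on_open (inv_into U f) (f ` U)"
    unfolding \<Psi>_def[symmetric]
  proof (rule smooth_on_open_if_derivation_closed[OF openW closed'])
    fix b :: 'a
    have "(\<lambda>x. x \<bullet> b) \<in> function_algebra A" by (rule function_algebra.gen) (auto simp: A_def)
    from imageI[OF this, of "\<lambda>r y. r (\<Psi> y)"]
    show "\<exists>q\<in>(\<lambda>r y. r (\<Psi> y)) ` function_algebra A. \<forall>y\<in>f ` U. \<Psi> y \<bullet> b = q y"
      by (rule bexI[rotated]) simp
  qed
qed

section \<open>Polynomial derivatives, gradients and projections\<close>

lemma frechet_derivative_polynomial_arith:
  assumes "real_polynomial_function f" "real_polynomial_function h"
  shows "frechet_derivative (\<lambda>x. f x + h x) (at x) v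
      = frechet_derivative f (at x) v + frechet_derivative h (at x) v"
    and "frechet_derivative (\<lambda>x. f x * h x) (at x) v
      = f x * frechet_derivative h (at x) v + frechet_derivative f (at x) v * h x"
proof -
  have d: "(f has_derivative frechet_derivative f (at x)) (at x)" "(h has_derivative frechet_derivative h (at x)) (at x)"
    using assms by (auto intro!: has_derivative_frechet differentiable_at_real_polynomial_function)
  show "frechet_derivative (\<lambda>x. f x + h x) (at x) v
      = frechet_derivative f (at x) v + frechet_derivative h (at x) v"
    using frechet_derivative_eq[OF has_derivative_add[OF d]] by simp
  show "frechet_derivative (\<lambda>x. f x * h x) (at x) v
      = f x * frechet_derivative h (at x) v + frechet_derivative f (at x) v * h x"
    using frechet_derivative_eq[OF has_derivative_mult[OF d]] by simp
qed

lemma polynomial_directional_derivative: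
  fixes f :: "'a::euclidean_space \<Rightarrow> real"
  assumes "real_polynomial_function f"
  shows "real_polynomial_function (\<lambda>x. frechet_derivative f (at x) v)"
  using assms
proof induction
  case (linear f)
  then have "frechet_derivative f (at x) v = f v" for x
    by (simp add: frechet_derivative_eq[OF bounded_linear_imp_has_derivative])
  then show ?case by (simp add: real_polynomial_function.intros(2))
next
  case (add f h)
  then show ?case by (simp add: frechet_derivative_polynomial_arith real_polynomial_function.intros(3))
next
  case (mult f h)
  then show ?case
    by (simp add: frechet_derivative_polynomial_arith real_polynomial_function.intros(3)
        real_polynomial_function.intros(4))
qed (simp add: real_polynomial_function.intros(2))

text \<open>For polynomial functions the symmetry of second derivatives is an identity that the product rule
preserves.\<close>

lemma polynomial_second_derivative_symmetric:
  fixes f :: "'a::euclidean_space \<Rightarrow> real"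
  assumes "real_polynomial_function f"
  shows "frechet_derivative (\<lambda>x. frechet_derivative f (at x) v) (at a) w
    = frechet_derivative (\<lambda>x. frechet_derivative f (at x) w) (at a) v"
  using assms
proof induction
  case (linear f)
  then have "frechet_derivative f (at x) v = f v" for x v
    by (simp add: frechet_derivative_eq[OF bounded_linear_imp_has_derivative])
  then show ?case by simp
next
  case (add f h)
  then show ?case
    by (simp add: frechet_derivative_polynomial_arith polynomial_directional_derivative)
next
  case (mult f h)
  then show ?case
    by (simp add: frechet_derivative_polynomial_arith polynomial_directional_derivative
        real_polynomial_function.intros(4))
qed simp

lemma GDERIV_unique:
  assumes "GDERIV f x :> D" "GDERIV f x :> D'"
  shows "D = D'"
proof -
  have "(\<lambda>h. inner h D) = (\<lambda>h. inner h D')"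
    using has_derivative_unique assms unfolding gderiv_def by blast
  from fun_cong[OF this, of "D - D'"] have "inner (D - D') (D - D') = 0"
    by (simp add: inner_diff_right)
  then show ?thesis by simp
qed

lemma gradient_eq: "GDERIV f x :> D \<Longrightarrow> gradient f x = D"
  unfolding gradient_def by (rule the_equality) (auto intro: GDERIV_unique)

lemma ex_orthogonal_projection:
  fixes E :: "'a::euclidean_space set"
  assumes "subspace E"
  obtains P where "linear P" "\<And>x. P x \<in> E" "\<And>x. x - P x \<in> E\<^sup>\<bottom>"
proof -
  obtain B where B: "B \<subseteq> E" "pairwise orthogonal B" "\<And>x. x \<in> B \<Longrightarrow> norm x = 1" "independent B" "span B = E"
    using orthonormal_basis_subspace[OF assms] by metis
  have fin: "finite B" using B(4) by (rule independent_imp_finite)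
  define P where "P x = (\<Sum>b\<in>B. (x \<bullet> b) *\<^sub>R b)" for x
  have "linear P"
    by (rule linearI) (simp_all add: P_def inner_add_left scaleR_add_left sum.distrib scaleR_sum_right)
  moreover have "P x \<in> E" for x
    unfolding P_def using B(1) assms by (auto intro!: subspace_sum subspace_scale)
  moreover have "x - P x \<in> E\<^sup>\<bottom>" for x
  proof -
    have "orthogonal (x - P x) c" if c: "c \<in> B" for c
    proof -
      have "P x \<bullet> c = (\<Sum>b\<in>B. if b = c then x \<bullet> c else 0)"
        unfolding P_def inner_sum_left inner_scaleR_left
      proof (rule sum.cong)
        fix b assume "b \<in> B"
        show "x \<bullet> b * (b \<bullet> c) = (if b = c then x \<bullet> c else 0)"
        proof (cases "b = c")
          case True
          then show ?thesis using B(3)[OF c] by (simp add: norm_eq_1)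
        next
          case False
          then have "b \<bullet> c = 0" using B(2) c \<open>b \<in> B\<close> by (simp add: pairwise_def orthogonal_def)
          then show ?thesis using False by simp
        qed
      qed simp
      also have "\<dots> = x \<bullet> c" using fin c by simp
      finally show ?thesis by (simp add: orthogonal_def inner_diff_left)
    qed
    then have "orthogonal (x - P x) y" if "y \<in> E" for y
      using orthogonal_to_span[of y B "x - P x"] that B(5) by blast
    then show ?thesis by (simp add: orthogonal_comp_def orthogonal_commute)
  qed
  ultimately show ?thesis by (rule that)
qed

section \<open>First and second derivatives of the logarithm\<close>

context hyperbolic_polynomial
begin

text \<open>The gradient of \<open>log g\<close> where \<open>g > 0\<close>. Written as a rational expression in polynomial functions,
it has derivatives of the same kind.\<close>

definition grad_ln :: "'a \<Rightarrow> 'a" where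
  "grad_ln x = (\<Sum>b\<in>Basis. (frechet_derivative g (at x) b / g x) *\<^sub>R b)"

lemma g_has_derivative: "(g has_derivative frechet_derivative g (at x)) (at x)"
  by (intro has_derivative_frechet differentiable_at_real_polynomial_function poly_g)

lemma inner_grad: "grad_ln x \<bullet> v = frechet_derivative g (at x) v / g x"
proof -
  have lin: "linear (frechet_derivative g (at x))" using g_has_derivative by (rule has_derivative_linear)
  have "frechet_derivative g (at x) (\<Sum>b\<in>Basis. (v \<bullet> b) *\<^sub>R b) = (\<Sum>b\<in>Basis. (v \<bullet> b) * frechet_derivative g (at x) b)"
    by (simp add: linear_sum[OF lin] linear_cmul[OF lin])
  then have "frechet_derivative g (at x) v = (\<Sum>b\<in>Basis. (v \<bullet> b) * frechet_derivative g (at x) b)"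
    by (simp only: euclidean_representation)
  then show ?thesis
    unfolding grad_ln_def inner_sum_left inner_scaleR_left
    by (simp add: sum_divide_distrib inner_commute mult.commute)
qed

lemma GDERIV_ln_g:
  assumes "x \<in> hyp_cone"
  shows "GDERIV (\<lambda>x. ln (g x)) x :> grad_ln x"
proof -
  have "((\<lambda>x. ln (g x)) has_derivative (\<lambda>h. frechet_derivative g (at x) h / g x)) (at x)"
    using g_pos[OF assms] g_has_derivative by (auto intro!: derivative_eq_intros simp: divide_simps)
  then show ?thesis
    unfolding gderiv_def using inner_grad by (simp add: inner_commute)
qed

text \<open>The algebra generated by the polynomial functions and \<open>1 / g\<close> is stable under derivatives. The
linear map is included so that both the gradient map and its extension by a projection are covered.\<close>

lemma smooth_grad_minus_linear:
  assumes "linear P"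
  shows "smooth_on_open (\<lambda>x. grad_ln x - P x) hyp_cone"
proof -
  define A where "A = Collect real_polynomial_function \<union> {\<lambda>x. 1 / g x}"
  have dg: "(\<lambda>x. frechet_derivative g (at x) v) \<in> function_algebra A" for v
    using polynomial_directional_derivative[OF poly_g] by (intro function_algebra.gen) (simp add: A_def)
  have inv: "(\<lambda>x. 1 / g x) \<in> function_algebra A" by (rule function_algebra.gen) (simp add: A_def)
  have der_inv: "((\<lambda>x. 1 / g x) has_derivative (\<lambda>h. - (frechet_derivative g (at x) h * (1 / g x) * (1 / g x)))) (at x)"
    if "x \<in> hyp_cone" for x
    using g_pos[OF that] g_has_derivative
    by (auto intro!: derivative_eq_intros simp: divide_simps power2_eq_square)
  have "derivation_closed hyp_cone (function_algebra A)"
  proof (rule derivation_closed_func_algebra)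
    fix r x assume "r \<in> A" "x \<in> hyp_cone"
    then consider "real_polynomial_function r" | "r = (\<lambda>x. 1 / g x)" by (auto simp: A_def)
    then show "r differentiable (at x)"
      by cases (use \<open>x \<in> hyp_cone\<close> in \<open>auto intro: differentiable_at_real_polynomial_function differentiableI[OF der_inv]\<close>)
  next
    fix r v assume "r \<in> A"
    then consider "real_polynomial_function r" | "r = (\<lambda>x. 1 / g x)" by (auto simp: A_def)
    then show "\<exists>r'\<in>function_algebra A. \<forall>x\<in>hyp_cone. frechet_derivative r (at x) v = r' x"
    proof cases
      case 1
      have "(\<lambda>x. frechet_derivative r (at x) v) \<in> function_algebra A"
        using polynomial_directional_derivative[OF 1] by (intro function_algebra.gen) (simp add: A_def)
      then show ?thesis by (rule bexI[rotated]) simp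
    next
      case 2
      have "(\<lambda>x. - (frechet_derivative g (at x) v * (1 / g x) * (1 / g x))) \<in> function_algebra A"
        by (intro func_algebra_uminus function_algebra.mult dg inv)
      then show ?thesis by (rule bexI[rotated]) (simp add: 2 frechet_derivative_eq[OF der_inv])
    qed
  qed
  then show ?thesis
  proof (rule smooth_on_open_if_derivation_closed[OF open_cone])
    fix b :: 'a
    have "bounded_linear (\<lambda>x. - (P x \<bullet> b))"
      using assms by (intro bounded_linear_minus bounded_linear_inner_left_comp) (simp add: linear_conv_bounded_linear)
    then have "(\<lambda>x. - (P x \<bullet> b)) \<in> function_algebra A"
      by (intro function_algebra.gen) (auto simp: A_def)
    then have "(\<lambda>x. frechet_derivative g (at x) b * (1 / g x) + - (P x \<bullet> b)) \<in> function_algebra A"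
      by (intro function_algebra.add function_algebra.mult dg inv)
    then show "\<exists>r\<in>function_algebra A. \<forall>x\<in>hyp_cone. (grad_ln x - P x) \<bullet> b = r x"
      by (rule bexI[rotated]) (simp add: inner_diff_left inner_grad)
  qed
qed

lemma smooth_grad: "smooth_on_open grad_ln hyp_cone"
  using smooth_grad_minus_linear[OF module_hom_zero] by simp

lemma grad_has_derivative:
  assumes "x \<in> hyp_cone"
  shows "(grad_ln has_derivative frechet_derivative grad_ln (at x)) (at x)"
  using smooth_on_openD(1)[OF smooth_grad assms] by (rule has_derivative_frechet)

lemma hessian_symmetric:
  assumes x: "x \<in> hyp_cone"
  shows "frechet_derivative grad_ln (at x) b \<bullet> c = frechet_derivative grad_ln (at x) c \<bullet> b"
proof -
  let ?d = "\<lambda>v x. frechet_derivative g (at x) v"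
  have *: "frechet_derivative grad_ln (at x) b \<bullet> c
    = (frechet_derivative (?d c) (at x) b * g x - ?d c x * ?d b x) / (g x)\<^sup>2" for b c
  proof -
    have "(?d c has_derivative frechet_derivative (?d c) (at x)) (at x)"
      by (intro has_derivative_frechet differentiable_at_real_polynomial_function
          polynomial_directional_derivative poly_g)
    then have "((\<lambda>y. ?d c y / g y) has_derivative
        (\<lambda>h. (frechet_derivative (?d c) (at x) h * g x - ?d c x * ?d h x) / (g x)\<^sup>2)) (at x)"
      using g_pos[OF x] g_has_derivative
      by (auto intro!: derivative_eq_intros simp: power2_eq_square)
    moreover have "((\<lambda>y. ?d c y / g y) has_derivative (\<lambda>h. frechet_derivative grad_ln (at x) h \<bullet> c)) (at x)"
      using has_derivative_inner_left[OF grad_has_derivative[OF x], of c] by (simp add: inner_grad)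
    ultimately have "(\<lambda>h. frechet_derivative grad_ln (at x) h \<bullet> c) =
        (\<lambda>h. (frechet_derivative (?d c) (at x) h * g x - ?d c x * ?d h x) / (g x)\<^sup>2)"
      using has_derivative_unique by blast
    then show ?thesis by (rule fun_cong)
  qed
  show ?thesis
    unfolding * polynomial_second_derivative_symmetric[OF poly_g, of c x b] by (simp add: mult.commute)
qed

lemma second_derivative_ln_g:
  assumes x: "x \<in> hyp_cone"
  shows "second_derivative (\<lambda>x. ln (g x)) x b c = frechet_derivative grad_ln (at x) b \<bullet> c"
proof -
  have "frechet_derivative (\<lambda>x. ln (g x)) (at y) b = grad_ln y \<bullet> b" if "y \<in> hyp_cone" for y
    using frechet_derivative_eq[OF GDERIV_ln_g[OF that, unfolded gderiv_def]] by (simp add: inner_commute)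
  moreover have d: "((\<lambda>y. grad_ln y \<bullet> b) has_derivative (\<lambda>h. frechet_derivative grad_ln (at x) h \<bullet> b)) (at x)"
    by (intro has_derivative_inner_left grad_has_derivative x)
  ultimately have "frechet_derivative (\<lambda>y. frechet_derivative (\<lambda>x. ln (g x)) (at y) b) (at x)
      = frechet_derivative (\<lambda>y. grad_ln y \<bullet> b) (at x)"
    by (intro frechet_derivative_cong_open(2)[OF open_cone x] differentiableI[OF d]) auto
  then show ?thesis
    unfolding second_derivative_def using frechet_derivative_eq[OF d] hessian_symmetric[OF x] by simp
qed

text \<open>Near \<open>s = 0\<close> the function \<open>log g (x + s b)\<close> is \<open>log g (x) + \<Sum> log (1 + s \<lambda>\<^sub>j)\<close>. Comparing
derivatives on the neighbourhood \<open>V\<close> gives the analogue of the first claim at each nearby point of the line, and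
differentiating once more gives the second.\<close>

lemma derivatives_in_eigenvalues:
  assumes x: "x \<in> hyp_cone" and lam: "\<And>t. g (t *\<^sub>R x + b) = g x * (\<Prod>j=1..N. t + lam j)"
  shows "grad_ln x \<bullet> b = (\<Sum>j=1..N. lam j)"
    and "frechet_derivative grad_ln (at x) b \<bullet> b = - (\<Sum>j=1..N. (lam j)\<^sup>2)"
proof -
  define V where "V = {s. x + s *\<^sub>R b \<in> hyp_cone} \<inter> (\<Inter>j\<in>{1..N}. {s. 0 < 1 + s * lam j})"
  have "open V" unfolding V_def
  proof (intro open_Int open_INT ballI)
    have "open ((\<lambda>s. x + s *\<^sub>R b) -` hyp_cone)"
      by (intro open_vimage open_cone continuous_intros)
    then show "open {s. x + s *\<^sub>R b \<in> hyp_cone}" by (simp add: vimage_def)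
  qed (auto intro!: open_Collect_less continuous_intros)
  have "0 \<in> V" using x by (simp add: V_def)
  have first: "grad_ln (x + s *\<^sub>R b) \<bullet> b = (\<Sum>j=1..N. lam j / (1 + s * lam j))" if s: "s \<in> V" for s
  proof -
    have line: "((\<lambda>s. x + s *\<^sub>R b) has_derivative (\<lambda>h. h *\<^sub>R b)) (at s)"
      by (auto intro!: derivative_eq_intros)
    have "((\<lambda>y. ln (g y)) has_derivative (\<lambda>h. h \<bullet> grad_ln (x + s *\<^sub>R b))) (at (x + s *\<^sub>R b))"
      using GDERIV_ln_g[of "x + s *\<^sub>R b"] s by (simp add: V_def gderiv_def)
    from has_derivative_compose[OF line this]
    have d1: "((\<lambda>s. ln (g (x + s *\<^sub>R b))) has_field_derivative grad_ln (x + s *\<^sub>R b) \<bullet> b) (at s)"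
      by (simp add: has_field_derivative_def mult_commute_abs inner_commute)
    have "((\<lambda>s. ln (g x) + (\<Sum>j=1..N. ln (1 + s * lam j))) has_field_derivative
        (\<Sum>j=1..N. lam j / (1 + s * lam j))) (at s)"
      using s by (auto simp: V_def intro!: derivative_eq_intros sum.cong)
    then have "((\<lambda>s. ln (g (x + s *\<^sub>R b))) has_field_derivative
        (\<Sum>j=1..N. lam j / (1 + s * lam j))) (at s)"
    proof (rule has_field_derivative_transform_within_open[OF _ \<open>open V\<close> s])
      fix r assume r: "r \<in> V"
      have "ln (g x * (\<Prod>j=1..N. 1 + r * lam j)) = ln (g x) + ln (\<Prod>j=1..N. 1 + r * lam j)"
        using r g_pos[OF x] by (intro ln_mult_pos) (auto simp: V_def intro!: prod_pos)
      also have "ln (\<Prod>j=1..N. 1 + r * lam j) = (\<Sum>j=1..N. ln (1 + r * lam j))"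
        using r by (intro ln_prod) (force simp: V_def)+
      finally show "ln (g x) + (\<Sum>j=1..N. ln (1 + r * lam j)) = ln (g (x + r *\<^sub>R b))"
        using g_line[OF lam] by simp
    qed
    from DERIV_unique[OF d1 this] show ?thesis .
  qed
  from first[OF \<open>0 \<in> V\<close>] show "grad_ln x \<bullet> b = (\<Sum>j=1..N. lam j)" by simp
  have "((\<lambda>s. \<Sum>j=1..N. lam j / (1 + s * lam j)) has_field_derivative - (\<Sum>j=1..N. (lam j)\<^sup>2)) (at 0)"
    by (auto intro!: derivative_eq_intros simp: sum_negf power2_eq_square)
  then have 1: "((\<lambda>s. grad_ln (x + s *\<^sub>R b) \<bullet> b) has_field_derivative - (\<Sum>j=1..N. (lam j)\<^sup>2)) (at 0)"
    by (rule has_field_derivative_transform_within_open[OF _ \<open>open V\<close> \<open>0 \<in> V\<close>]) (simp add: first)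
  have line: "((\<lambda>s. x + s *\<^sub>R b) has_derivative (\<lambda>h. h *\<^sub>R b)) (at (0::real))"
    by (auto intro!: derivative_eq_intros)
  have "((\<lambda>y. grad_ln y \<bullet> b) has_derivative (\<lambda>h. frechet_derivative grad_ln (at x) h \<bullet> b)) (at (x + 0 *\<^sub>R b))"
    using has_derivative_inner_left[OF grad_has_derivative[OF x]] by simp
  from has_derivative_compose[OF line this]
  have "((\<lambda>s. grad_ln (x + s *\<^sub>R b) \<bullet> b) has_field_derivative frechet_derivative grad_ln (at x) b \<bullet> b) (at 0)"
    using linear_cmul[OF has_derivative_linear[OF grad_has_derivative[OF x]]]
    by (simp add: has_field_derivative_def mult_commute_abs)
  from DERIV_unique[OF this 1]
  show "frechet_derivative grad_ln (at x) b \<bullet> b = - (\<Sum>j=1..N. (lam j)\<^sup>2)" .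
qed

lemma hessian_nonpos:
  assumes x: "x \<in> hyp_cone"
  shows "frechet_derivative grad_ln (at x) b \<bullet> b \<le> 0"
    and "frechet_derivative grad_ln (at x) b \<bullet> b = 0 \<Longrightarrow> b \<in> lineality"
proof -
  obtain lam where lam: "\<And>t. g (t *\<^sub>R x + b) = g x * (\<Prod>j=1..N. t + lam j)"
    using factorization[OF x] by blast
  note h = derivatives_in_eigenvalues(2)[OF x lam]
  show "frechet_derivative grad_ln (at x) b \<bullet> b \<le> 0"
    unfolding h by (simp add: sum_nonneg)
  assume "frechet_derivative grad_ln (at x) b \<bullet> b = 0"
  then have "\<forall>j\<in>{1..N}. (lam j)\<^sup>2 = 0"
    unfolding h by (subst sum_nonneg_eq_0_iff[symmetric]) auto
  then have "(\<Prod>j=1..N. t + lam j) = t ^ N" for t by simp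
  then show "b \<in> lineality"
    unfolding lineality_iff_eigenvalues[OF x] using lam by simp
qed

lemma grad_orthogonal_lineality:
  assumes x: "x \<in> hyp_cone" and c: "c \<in> lineality"
  shows "grad_ln x \<bullet> c = 0"
proof -
  have "g (t *\<^sub>R x + c) = g x * (\<Prod>j=1..N. t + 0)" for t
    using c unfolding lineality_iff_eigenvalues[OF x] by simp
  from derivatives_in_eigenvalues(1)[OF x this] show ?thesis by simp
qed

text \<open>The function \<open>g\<close> itself is invariant under translation by the edge.\<close>

lemma grad_add_lineality:
  assumes x: "x \<in> hyp_cone" and c: "c \<in> lineality"
  shows "grad_ln (x + c) = grad_ln x"
proof -
  have "((\<lambda>y. y + c) has_derivative (\<lambda>h. h)) (at x)" by (auto intro!: derivative_eq_intros)
  from has_derivative_compose[OF this GDERIV_ln_g[OF cone_add_lineality[OF x c], unfolded gderiv_def]]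
  have "((\<lambda>y. ln (g (y + c))) has_derivative (\<lambda>h. h \<bullet> grad_ln (x + c))) (at x)" .
  then have "GDERIV (\<lambda>y. ln (g y)) x :> grad_ln (x + c)"
    unfolding gderiv_def
    by (rule has_derivative_transform_within_open[OF _ open_cone x]) (simp add: g_add_lineality c)
  from GDERIV_unique[OF this GDERIV_ln_g[OF x]] show ?thesis .
qed

lemma grad_pos:
  assumes x: "x \<in> hyp_cone" and a: "a \<in> hyp_cone"
  shows "grad_ln x \<bullet> a \<ge> 0"
proof -
  obtain lam where lam: "\<And>t. g (t *\<^sub>R x + a) = g x * (\<Prod>j=1..N. t + lam j)"
    using factorization[OF x] by blast
  show ?thesis
    unfolding derivatives_in_eigenvalues(1)[OF x lam]
    by (intro sum_nonneg less_imp_le[OF eigenvalues_pos_at[OF x a lam]])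
qed

end

section \<open>The gradient map as a diffeomorphism\<close>

context hyperbolic_polynomial
begin

text \<open>The span: the orthogonal complement of the edge, which represents the quotient by the edge.\<close>

definition essential :: "'a set" where
  "essential = lineality\<^sup>\<bottom>"

lemma subspace_essential: "subspace essential"
  by (simp add: essential_def subspace_orthogonal_comp)

lemma essential_iff: "x \<in> essential \<longleftrightarrow> (\<forall>c\<in>lineality. c \<bullet> x = 0)"
  by (simp add: essential_def orthogonal_comp_def orthogonal_def)

lemma lineality_Int_essential:
  assumes "x \<in> lineality" "x \<in> essential"
  shows "x = 0"
  using assms essential_iff[of x] by auto

text \<open>The orthogonal projection onto the edge.\<close>

definition proj :: "'a \<Rightarrow> 'a" where
  "proj = (SOME P. linear P \<and> (\<forall>x. P x \<in> lineality \<and> x - P x \<in> essential))"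

lemma linear_proj: "linear proj"
  and proj_lineality: "proj x \<in> lineality"
  and diff_proj_essential: "x - proj x \<in> essential"
proof -
  have "\<exists>P. linear P \<and> (\<forall>x. P x \<in> lineality \<and> x - P x \<in> essential)"
    using ex_orthogonal_projection[OF subspace_lineality] unfolding essential_def by metis
  from someI_ex[OF this] show "linear proj" "proj x \<in> lineality" "x - proj x \<in> essential"
    unfolding proj_def[symmetric] by auto
qed

lemma proj_essential:
  assumes "x \<in> essential"
  shows "proj x = 0"
proof (rule lineality_Int_essential[OF proj_lineality])
  have "x - (x - proj x) \<in> essential"
    using assms diff_proj_essential subspace_diff[OF subspace_essential] by blast
  then show "proj x \<in> essential" by simp
qed

lemma proj_lineality_id:
  assumes "x \<in> lineality"
  shows "proj x = x"
proof -
  have "x - proj x \<in> lineality"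
    using assms proj_lineality subspace_diff[OF subspace_lineality] by blast
  then have "x - proj x = 0" using lineality_Int_essential diff_proj_essential by blast
  then show ?thesis by simp
qed

lemma inner_proj: "proj x \<bullet> x = proj x \<bullet> proj x"
proof -
  have "proj x \<bullet> (x - proj x) = 0"
    using diff_proj_essential proj_lineality essential_iff by blast
  then show ?thesis by (simp add: inner_diff_right)
qed

lemma diff_proj_cone:
  assumes "x \<in> hyp_cone"
  shows "x - proj x \<in> hyp_cone"
  using cone_add_lineality[OF assms, of "- proj x"] subspace_neg[OF subspace_lineality proj_lineality] by simp

lemma grad_essential:
  assumes "x \<in> hyp_cone"
  shows "grad_ln x \<in> essential"
  using grad_orthogonal_lineality[OF assms] by (simp add: essential_iff inner_commute)

text \<open>Subtracting the projection removes the degeneracy along the edge without changing the map on the span.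
The sign is chosen so that both parts of the derivative are negative semidefinite.\<close>

definition grad_ext :: "'a \<Rightarrow> 'a" where
  "grad_ext x = grad_ln x - proj x"

lemma smooth_extended_grad: "smooth_on_open grad_ext hyp_cone"
  using smooth_grad_minus_linear[OF linear_proj] unfolding grad_ext_def .

text \<open>The Hessian of \<open>log g\<close> degenerates only along the edge, and there the projection is the identity.\<close>

lemma extended_grad_derivative_negative:
  assumes x: "x \<in> hyp_cone" and b: "b \<noteq> 0"
  shows "frechet_derivative grad_ext (at x) b \<bullet> b < 0"
proof -
  have "(grad_ext has_derivative (\<lambda>h. frechet_derivative grad_ln (at x) h - proj h)) (at x)"
    unfolding grad_ext_def[abs_def]
    by (intro has_derivative_diff grad_has_derivative x linear_imp_has_derivative linear_proj)
  then have eq: "frechet_derivative grad_ext (at x) b \<bullet> b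
      = frechet_derivative grad_ln (at x) b \<bullet> b - proj b \<bullet> proj b"
    by (simp add: frechet_derivative_eq inner_diff_left inner_proj)
  have False if 0: "frechet_derivative grad_ln (at x) b \<bullet> b - proj b \<bullet> proj b \<ge> 0"
  proof -
    have "proj b \<bullet> proj b \<ge> 0" by simp
    then have "frechet_derivative grad_ln (at x) b \<bullet> b = 0" "proj b \<bullet> proj b = 0"
      using hessian_nonpos(1)[OF x, of b] 0 by linarith+
    then show False using hessian_nonpos(2)[OF x] proj_lineality_id[of b] b by auto
  qed
  then show ?thesis unfolding eq by force
qed

lemma inj_extended_grad_derivative:
  assumes x: "x \<in> hyp_cone"
  shows "inj (frechet_derivative grad_ext (at x))"
proof -
  have "linear (frechet_derivative grad_ext (at x))"
    by (intro linear_frechet_derivative smooth_on_openD(1)[OF smooth_extended_grad x])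
  moreover have "b = 0" if "frechet_derivative grad_ext (at x) b = 0" for b
    using extended_grad_derivative_negative[OF x, of b] that by auto
  ultimately show ?thesis by (simp add: linear_injective_0)
qed

text \<open>A map with negative definite derivative on a convex set is strictly monotone along each segment.\<close>

lemma inj_on_extended_grad: "inj_on grad_ext hyp_cone"
proof (rule inj_onI, rule ccontr)
  fix x y assume xy: "x \<in> hyp_cone" "y \<in> hyp_cone" "grad_ext x = grad_ext y" "x \<noteq> y"
  define v where "v = y - x"
  define k where "k s = grad_ext (x + s *\<^sub>R v) \<bullet> v" for s :: real
  have k: "(k has_field_derivative frechet_derivative grad_ext (at (x + s *\<^sub>R v)) v \<bullet> v) (at s)"
    if s: "0 \<le> s" "s \<le> 1" for s
  proof -
    have "x + s *\<^sub>R v = (1 - s) *\<^sub>R x + s *\<^sub>R y" by (simp add: v_def algebra_simps)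
    then have "x + s *\<^sub>R v \<in> hyp_cone" using convexD[OF convex_cone xy(1,2), of "1 - s" s] s by simp
    then have d: "grad_ext differentiable (at (x + s *\<^sub>R v))"
      by (rule smooth_on_openD(1)[OF smooth_extended_grad])
    have line: "((\<lambda>s. x + s *\<^sub>R v) has_derivative (\<lambda>h. h *\<^sub>R v)) (at s)"
      by (auto intro!: derivative_eq_intros)
    have "(k has_derivative (\<lambda>h. frechet_derivative grad_ext (at (x + s *\<^sub>R v)) (h *\<^sub>R v) \<bullet> v)) (at s)"
      unfolding k_def[abs_def]
      by (intro has_derivative_inner_left has_derivative_compose[OF line has_derivative_frechet[OF d]])
    then show ?thesis
      by (simp add: linear_cmul[OF linear_frechet_derivative[OF d]] has_field_derivative_def mult_commute_abs)
  qed
  obtain z where z: "0 < z" "z < 1"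
    "k 1 - k 0 = (1 - 0) * (frechet_derivative grad_ext (at (x + z *\<^sub>R v)) v \<bullet> v)"
    using MVT2[of 0 1 k "\<lambda>s. frechet_derivative grad_ext (at (x + s *\<^sub>R v)) v \<bullet> v"] k by auto
  have "x + z *\<^sub>R v = (1 - z) *\<^sub>R x + z *\<^sub>R y" by (simp add: v_def algebra_simps)
  then have "x + z *\<^sub>R v \<in> hyp_cone" using convexD[OF convex_cone xy(1,2), of "1 - z" z] z by simp
  then have "k 1 - k 0 < 0"
    using extended_grad_derivative_negative[of "x + z *\<^sub>R v" v] z xy(4) by (simp add: v_def)
  moreover have "k 1 = k 0" using xy(3) by (simp add: k_def v_def)
  ultimately show False by simp
qed

lemma extended_grad_eq_grad: "x \<in> essential \<Longrightarrow> grad_ext x = grad_ln x"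
  by (simp add: grad_ext_def proj_essential)

definition dual_cone :: "'a set" where
  "dual_cone = {b. \<forall>a\<in>hyp_cone. b \<bullet> a \<ge> 0}"

text \<open>The image is the trace on the span of the image of the extended map, which is open by
\<open>smooth_inverse\<close>.\<close>

lemma openin_grad_image: "openin (top_of_set essential) (grad_ln ` (hyp_cone \<inter> essential))"
proof -
  have "grad_ln ` (hyp_cone \<inter> essential) = essential \<inter> grad_ext ` hyp_cone"
  proof (intro set_eqI iffI)
    fix y assume "y \<in> grad_ln ` (hyp_cone \<inter> essential)"
    then obtain x where x: "x \<in> hyp_cone" "x \<in> essential" "y = grad_ln x" by auto
    then have "y = grad_ext x" by (simp add: extended_grad_eq_grad)
    moreover have "y \<in> essential" using x grad_essential by simp
    ultimately show "y \<in> essential \<inter> grad_ext ` hyp_cone" using x(1) by blast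
  next
    fix y assume "y \<in> essential \<inter> grad_ext ` hyp_cone"
    then obtain x where x: "x \<in> hyp_cone" "y = grad_ln x - proj x" "y \<in> essential"
      by (auto simp: grad_ext_def)
    have "grad_ln x - y \<in> essential"
      using x grad_essential subspace_diff[OF subspace_essential] by blast
    then have 0: "proj x = 0" using x(2) lineality_Int_essential[OF proj_lineality] by simp
    then have "x \<in> essential" using diff_proj_essential[of x] by simp
    then show "y \<in> grad_ln ` (hyp_cone \<inter> essential)" using x 0 by auto
  qed
  moreover have "open (grad_ext ` hyp_cone)"
    by (intro smooth_inverse(1) open_cone smooth_extended_grad inj_on_extended_grad
        inj_extended_grad_derivative)
  ultimately show ?thesis by (simp add: openin_open_Int)
qed

lemma closed_dual_inner:
  assumes "b \<in> dual_cone" "x \<in> closure hyp_cone"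
  shows "b \<bullet> x \<ge> 0"
proof -
  have "closed {x. 0 \<le> b \<bullet> x}" by (intro closed_Collect_le continuous_intros)
  moreover have "hyp_cone \<subseteq> {x. 0 \<le> b \<bullet> x}" using assms(1) by (auto simp: dual_cone_def)
  ultimately have "closure hyp_cone \<subseteq> {x. 0 \<le> b \<bullet> x}" by (rule closure_minimal[rotated])
  then show ?thesis using assms(2) by blast
qed

text \<open>If \<open>b\<close> is interior, \<open>b\<close> minus a small multiple of \<open>x / norm x\<close> is still in the dual cone; evaluate
it at \<open>x\<close>.\<close>

lemma interior_dual_coercive:
  assumes "b \<in> top_of_set essential interior_of dual_cone"
  obtains \<delta> where "\<delta> > 0" "\<And>x. x \<in> closure hyp_cone \<Longrightarrow> x \<in> essential \<Longrightarrow> \<delta> * norm x \<le> b \<bullet> x"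
proof -
  obtain T where T: "openin (top_of_set essential) T" "b \<in> T" "T \<subseteq> dual_cone"
    using assms by (auto simp: interior_of_def)
  then obtain r where r: "r > 0" "ball b r \<inter> essential \<subseteq> T"
    unfolding openin_contains_ball by blast
  have b: "b \<in> essential" using T openin_imp_subset by blast
  have "r / 2 * norm x \<le> b \<bullet> x" if x: "x \<in> closure hyp_cone" "x \<in> essential" for x
  proof (cases "x = 0")
    case False
    define y where "y = b - (r / 2 / norm x) *\<^sub>R x"
    have "y \<in> essential" unfolding y_def
      using b x(2) subspace_essential by (intro subspace_diff subspace_scale) auto
    moreover have "y \<in> ball b r"
      using False r(1) by (simp add: y_def dist_norm)
    ultimately have "y \<in> dual_cone" using r(2) T(3) by blast
    then have "0 \<le> y \<bullet> x" using x(1) by (rule closed_dual_inner)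
    also have "y \<bullet> x = b \<bullet> x - r / 2 / norm x * (norm x)\<^sup>2"
      by (simp add: y_def inner_diff_left power2_norm_eq_inner)
    finally show ?thesis using False by (simp add: power2_eq_square)
  qed simp
  with r(1) show ?thesis by (intro that[of "r / 2"]) auto
qed

lemma closure_cone_g_nz:
  assumes "x \<in> closure hyp_cone" "g x \<noteq> 0"
  shows "x \<in> hyp_cone"
  unfolding cone_iff
proof (intro allI impI)
  fix t :: real assume "t \<ge> 0"
  show "g (x + t *\<^sub>R e) \<noteq> 0"
  proof (cases "t = 0")
    case False
    then have "t *\<^sub>R e + x \<in> hyp_cone"
      using assms(1) \<open>t \<ge> 0\<close> cone_scaleR[OF e_in_cone, of t] by (simp add: closure_cone_iff)
    then show ?thesis using g_pos[of "t *\<^sub>R e + x"] by (simp add: add.commute)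
  qed (use assms in simp)
qed

text \<open>Euler's identity: all \<open>x\<close>-eigenvalues of \<open>x\<close> are \<open>1\<close>.\<close>

lemma grad_self:
  assumes x: "x \<in> hyp_cone"
  shows "grad_ln x \<bullet> x = N"
proof -
  have "g (t *\<^sub>R x + x) = g x * (\<Prod>j=1..N. t + 1)" for t
    using scale_g[of "t + 1" x] by (simp add: scaleR_add_left)
  from derivatives_in_eigenvalues(1)[OF x this] show ?thesis by simp
qed

text \<open>A Lagrange multiplier argument. The slice \<open>K\<close> of the closed cone in the span where \<open>\<langle>b, x\<rangle> = N\<close> is
compact because \<open>b\<close> grows linearly there. A maximiser of \<open>g\<close> on \<open>K\<close> has \<open>g > 0\<close>, so it
lies in the open cone and is critical for all directions in the span orthogonal to \<open>b\<close>. The level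
\<open>N\<close> of the slice is the one for which Euler's identity gives the multiplier \<open>1\<close>.\<close>

lemma grad_surj:
  assumes N: "N \<ge> 1" and b: "b \<in> top_of_set essential interior_of dual_cone"
  obtains x where "x \<in> hyp_cone \<inter> essential" "grad_ln x = b"
proof -
  obtain \<delta> where \<delta>: "\<delta> > 0" "\<And>x. x \<in> closure hyp_cone \<Longrightarrow> x \<in> essential \<Longrightarrow> \<delta> * norm x \<le> b \<bullet> x"
    using interior_dual_coercive[OF b] by blast
  have b_ess: "b \<in> essential" by (rule subsetD[OF interior_of_subset_subtopology b])
  define K where "K = {x \<in> closure hyp_cone \<inter> essential. b \<bullet> x = N}"
  have "compact K"
  proof -
    have "closed (closure hyp_cone \<inter> essential \<inter> {x. b \<bullet> x = N})"
      by (intro closed_Int closed_closure closed_subspace subspace_essential closed_Collect_eq continuous_intros)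
    moreover have "K = closure hyp_cone \<inter> essential \<inter> {x. b \<bullet> x = N}" by (auto simp: K_def)
    moreover have "K \<subseteq> cball 0 (N / \<delta>)"
      using \<delta> by (force simp: K_def pos_le_divide_eq mult.commute)
    ultimately show ?thesis
      using bounded_subset[OF bounded_cball] by (simp add: compact_eq_bounded_closed)
  qed
  define a where "a = e - proj e"
  have a: "a \<in> hyp_cone" "a \<in> essential"
    unfolding a_def using diff_proj_cone[OF e_in_cone] diff_proj_essential by auto
  have "a \<noteq> 0"
  proof
    assume "a = 0"
    then have "g a = 0" using scale_g[of 0 0] N by (simp add: power_0_left)
    then show False using g_pos[OF a(1)] by simp
  qed
  have ba: "b \<bullet> a > 0"
    using \<delta>(2)[of a] \<delta>(1) a \<open>a \<noteq> 0\<close> closure_subset[of hyp_cone]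
    by (smt (verit) in_mono mult_pos_pos zero_less_norm_iff)
  define a' where "a' = (N / (b \<bullet> a)) *\<^sub>R a"
  have a': "a' \<in> hyp_cone" "a' \<in> K"
  proof -
    show "a' \<in> hyp_cone" unfolding a'_def using N ba by (intro cone_scaleR a) simp
    moreover have "a' \<in> essential"
      unfolding a'_def by (rule subspace_scale[OF subspace_essential a(2)])
    moreover have "b \<bullet> a' = N" using ba by (simp add: a'_def)
    ultimately show "a' \<in> K" unfolding K_def using closure_subset[of hyp_cone] by blast
  qed
  obtain x where x: "x \<in> K" "\<And>y. y \<in> K \<Longrightarrow> g y \<le> g x"
    using continuous_attains_sup[OF \<open>compact K\<close>, of g] a'(2) continuous_on_g[OF continuous_on_id] by blast
  have "g x > 0" using x(2)[OF a'(2)] g_pos[OF a'(1)] by simp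
  then have x_cone: "x \<in> hyp_cone" using x(1) closure_cone_g_nz by (auto simp: K_def)
  have x_ess: "x \<in> essential" and bx: "b \<bullet> x = N" using x(1) by (auto simp: K_def)
  have crit: "grad_ln x \<bullet> v = 0" if v: "v \<in> essential" "b \<bullet> v = 0" for v
  proof -
    have line: "((\<lambda>s. x + s *\<^sub>R v) has_derivative (\<lambda>h. h *\<^sub>R v)) (at (0::real))"
      by (auto intro!: derivative_eq_intros)
    have "(g has_derivative frechet_derivative g (at x)) (at (x + 0 *\<^sub>R v))"
      using g_has_derivative by simp
    from has_derivative_compose[OF line this]
    have der: "((\<lambda>s. g (x + s *\<^sub>R v)) has_field_derivative frechet_derivative g (at x) v) (at 0)"
      using linear_cmul[OF has_derivative_linear[OF g_has_derivative]]
      by (simp add: has_field_derivative_def mult_commute_abs)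
    have "open ((\<lambda>s::real. x + s *\<^sub>R v) -` hyp_cone)"
      by (intro open_vimage open_cone continuous_intros)
    moreover have "0 \<in> (\<lambda>s::real. x + s *\<^sub>R v) -` hyp_cone" using x_cone by simp
    ultimately obtain d where d: "d > 0" "ball 0 d \<subseteq> (\<lambda>s::real. x + s *\<^sub>R v) -` hyp_cone"
      using openE by blast
    have "g (x + s *\<^sub>R v) \<le> g (x + 0 *\<^sub>R v)" if "\<bar>0 - s\<bar> < d" for s
    proof -
      have "x + s *\<^sub>R v \<in> hyp_cone" using d(2) that by (auto simp: dist_norm)
      moreover have "x + s *\<^sub>R v \<in> essential"
        by (intro subspace_add subspace_scale subspace_essential x_ess v(1))
      moreover have "b \<bullet> (x + s *\<^sub>R v) = N" using bx v(2) by (simp add: inner_add_right)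
      ultimately have "x + s *\<^sub>R v \<in> K" unfolding K_def using closure_subset[of hyp_cone] by blast
      then show ?thesis using x(2) by simp
    qed
    then have "frechet_derivative g (at x) v = 0" using DERIV_local_max[OF der d(1)] by blast
    then show ?thesis by (simp add: inner_grad)
  qed
  have "b \<noteq> 0" using bx N by auto
  define \<kappa> where "\<kappa> = (grad_ln x \<bullet> b) / (b \<bullet> b)"
  define v where "v = grad_ln x - \<kappa> *\<^sub>R b"
  have v: "v \<in> essential" unfolding v_def
    using grad_essential[OF x_cone] b_ess subspace_essential by (intro subspace_diff subspace_scale) auto
  have bv: "b \<bullet> v = 0"
    using \<open>b \<noteq> 0\<close> by (simp add: v_def \<kappa>_def inner_diff_right inner_commute)
  have "v \<bullet> v = 0" using crit[OF v bv] bv by (simp add: v_def inner_diff_left inner_diff_right inner_commute)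
  then have eq: "grad_ln x = \<kappa> *\<^sub>R b" by (simp add: v_def)
  have "\<kappa> * N = N" using grad_self[OF x_cone] bx by (simp add: eq)
  then have "grad_ln x = b" using eq N by simp
  then show ?thesis using x_cone x_ess by (intro that[of x]) auto
qed

lemma grad_image:
  assumes "N \<ge> 1"
  shows "grad_ln ` (hyp_cone \<inter> essential) = top_of_set essential interior_of dual_cone"
proof
  have "grad_ln ` (hyp_cone \<inter> essential) \<subseteq> dual_cone" using grad_pos by (auto simp: dual_cone_def)
  then show "grad_ln ` (hyp_cone \<inter> essential) \<subseteq> top_of_set essential interior_of dual_cone"
    by (intro interior_of_maximal openin_grad_image)
  show "top_of_set essential interior_of dual_cone \<subseteq> grad_ln ` (hyp_cone \<inter> essential)"
  proof
    fix b assume "b \<in> top_of_set essential interior_of dual_cone"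
    from grad_surj[OF assms this] show "b \<in> grad_ln ` (hyp_cone \<inter> essential)" by blast
  qed
qed

lemma inj_on_grad: "inj_on grad_ln (hyp_cone \<inter> essential)"
proof (rule inj_onI)
  fix x y assume "x \<in> hyp_cone \<inter> essential" "y \<in> hyp_cone \<inter> essential" "grad_ln x = grad_ln y"
  then show "x = y" using inj_onD[OF inj_on_extended_grad, of x y] by (simp add: extended_grad_eq_grad)
qed

text \<open>The smooth extension of the inverse that smoothness on a subset of the span asks for is the inverse of
the extended map on its open image.\<close>

lemma diffeomorphism_grad:
  assumes N: "N \<ge> 1" and F: "\<And>x. x \<in> hyp_cone \<Longrightarrow> F x = grad_ln x"
  shows "diffeomorphism_betw F (hyp_cone \<inter> essential) (top_of_set essential interior_of dual_cone)"
proof -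
  have img: "F ` (hyp_cone \<inter> essential) = grad_ln ` (hyp_cone \<inter> essential)" using F by auto
  have inj: "inj_on F (hyp_cone \<inter> essential)"
    using inj_on_grad F by (simp add: inj_on_def)
  have "bij_betw F (hyp_cone \<inter> essential) (grad_ln ` (hyp_cone \<inter> essential))"
    using inj img by (simp add: bij_betw_def)
  moreover have "smooth_map_on (hyp_cone \<inter> essential) F"
    unfolding smooth_map_on_def
    using open_cone smooth_grad F by (intro ballI exI[of _ hyp_cone] exI[of _ grad_ln]) auto
  moreover have "smooth_map_on (grad_ln ` (hyp_cone \<inter> essential)) (inv_into (hyp_cone \<inter> essential) F)"
    unfolding smooth_map_on_def
  proof (intro ballI exI conjI)
    fix y assume "y \<in> grad_ln ` (hyp_cone \<inter> essential)"
    then obtain x where x: "x \<in> hyp_cone" "x \<in> essential" "y = grad_ln x" by auto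
    note I = smooth_inverse[OF open_cone smooth_extended_grad inj_on_extended_grad inj_extended_grad_derivative]
    show "open (grad_ext ` hyp_cone)" "smooth_on_open (inv_into hyp_cone grad_ext) (grad_ext ` hyp_cone)"
      by (rule I, assumption)+
    show "y \<in> grad_ext ` hyp_cone" using x extended_grad_eq_grad[OF x(2)] by (intro image_eqI[of _ _ x]) auto
    fix z assume "z \<in> grad_ln ` (hyp_cone \<inter> essential) \<inter> grad_ext ` hyp_cone"
    then obtain w where w: "w \<in> hyp_cone" "w \<in> essential" "z = grad_ln w" by auto
    have "inv_into hyp_cone grad_ext z = w"
      using inv_into_f_f[OF inj_on_extended_grad w(1)] extended_grad_eq_grad[OF w(2)] w(3) by simp
    moreover have "inv_into (hyp_cone \<inter> essential) F z = w"
      using inv_into_f_f[OF inj, of w] F[OF w(1)] w by simp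
    ultimately show "inv_into hyp_cone grad_ext z = inv_into (hyp_cone \<inter> essential) F z" by simp
  qed
  ultimately show ?thesis
    unfolding diffeomorphism_betw_def grad_image[OF N] by simp
qed

text \<open>The representative is obtained by removing the component of \<open>a\<close> along the edge.\<close>

lemma ex1_essential_representative:
  assumes a: "a \<in> hyp_cone"
  shows "\<exists>!a'. a' \<in> hyp_cone \<inter> essential \<and> a - a' \<in> lineality"
proof (rule ex1I[of _ "a - proj a"])
  show "a - proj a \<in> hyp_cone \<inter> essential \<and> a - (a - proj a) \<in> lineality"
    using diff_proj_cone[OF a] diff_proj_essential proj_lineality by simp
  fix a' assume a': "a' \<in> hyp_cone \<inter> essential \<and> a - a' \<in> lineality"
  have "proj a = proj a' + proj (a - a')"
    using linear_add[OF linear_proj, of a' "a - a'"] by simp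
  then show "a' = a - proj a" using a' by (simp add: proj_essential proj_lineality_id)
qed

text \<open>The gradient is constant along the edge, so the edge lies in the kernel of the symmetric form.\<close>

lemma hessian_add_lineality:
  assumes x: "x \<in> hyp_cone" and c: "c \<in> lineality"
  shows "frechet_derivative grad_ln (at x) (b + c) \<bullet> (b + c) = frechet_derivative grad_ln (at x) b \<bullet> b"
proof -
  have line: "((\<lambda>s. x + s *\<^sub>R c) has_derivative (\<lambda>h. h *\<^sub>R c)) (at (0::real))"
    by (auto intro!: derivative_eq_intros)
  have "(grad_ln has_derivative frechet_derivative grad_ln (at x)) (at (x + 0 *\<^sub>R c))"
    using grad_has_derivative[OF x] by simp
  from has_derivative_compose[OF line this]
  have "((\<lambda>s. grad_ln x) has_derivative (\<lambda>h. frechet_derivative grad_ln (at x) (h *\<^sub>R c))) (at 0)"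
    using grad_add_lineality[OF x] c by (simp add: subspace_scale[OF subspace_lineality])
  moreover have "((\<lambda>s. grad_ln x) has_derivative (\<lambda>h. 0)) (at (0::real))" by (rule has_derivative_const)
  ultimately have "(\<lambda>h::real. frechet_derivative grad_ln (at x) (h *\<^sub>R c)) = (\<lambda>h. 0)"
    using has_derivative_unique by blast
  from fun_cong[OF this, of 1] have c0: "frechet_derivative grad_ln (at x) c = 0" by simp
  have "frechet_derivative grad_ln (at x) b \<bullet> c = 0"
    using hessian_symmetric[OF x, of b c] c0 by simp
  then show ?thesis
    using linear_add[OF has_derivative_linear[OF grad_has_derivative[OF x]], of b c] c0
    by (simp add: inner_add_right)
qed

end

theorem theorem7p4:
  fixes g :: "('n::finite) symmat \<Rightarrow> real" and N :: nat
    and \<Gamma> E S :: "'n symmat set"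
    and log_g :: "'n symmat \<Rightarrow> real" and F :: "'n symmat \<Rightarrow> 'n symmat"
  assumes "N \<ge> 1" and "garding_dirichlet N g"
  defines "\<Gamma> \<equiv> garding_cone g"
    and "E \<equiv> edge g"
    and "S \<equiv> garding_span g"
    and "log_g \<equiv> \<lambda>A. ln (g A)"
    and "F \<equiv> gradient log_g"
  shows
    "(\<forall>A\<in>\<Gamma>. g A > 0 \<and> GDERIV log_g A :> F A) \<and>
     (\<forall>A\<in>\<Gamma>. \<forall>C\<in>E. A + C \<in> \<Gamma> \<and> F (A + C) = F A) \<and>
     (\<forall>A\<in>\<Gamma>. \<exists>!A'. A' \<in> \<Gamma> \<inter> S \<and> A - A' \<in> E) \<and>
     diffeomorphism_betw F (\<Gamma> \<inter> S) (open_polar g) \<and>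
     (\<forall>A\<in>\<Gamma>.
        F differentiable (at A) \<and>
        (\<forall>B C. inner (frechet_derivative F (at A) B) C = second_derivative log_g A B C) \<and>
        (\<forall>B. \<forall>C\<in>E. second_derivative log_g A (B + C) (B + C) = second_derivative log_g A B B) \<and>
        (\<forall>B. \<exists>lam. garding_eigenvalues g N A B lam) \<and>
        (\<forall>B lam. garding_eigenvalues g N A B lam \<longrightarrow>
           second_derivative log_g A B B = - (\<Sum>j=1..N. (lam j)\<^sup>2)) \<and>
        (\<forall>B\<in>S. B \<noteq> 0 \<longrightarrow> second_derivative log_g A B B < 0))"
proof -
  interpret hyperbolic_polynomial N g id_symmat
    using assms(2) by unfold_locales (auto simp: garding_dirichlet_def)
  have \<Gamma>: "\<Gamma> = hyp_cone" by (simp add: \<Gamma>_def garding_cone_def hyp_cone_def)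
  have E: "E = lineality" using \<Gamma> by (simp add: E_def edge_def lineality_def \<Gamma>_def)
  have S: "S = essential" using E by (simp add: S_def garding_span_def essential_def E_def)
  have polar: "open_polar g = top_of_set essential interior_of dual_cone"
    using \<Gamma> S by (simp add: open_polar_def closed_polar_def dual_cone_def \<Gamma>_def S_def)
  have grad_ln: "GDERIV log_g A :> grad_ln A" "F A = grad_ln A" if "A \<in> hyp_cone" for A
    using GDERIV_ln_g[OF that] gradient_eq by (auto simp: log_g_def F_def)
  have F: "F differentiable (at A)" "frechet_derivative F (at A) = frechet_derivative grad_ln (at A)"
    if "A \<in> hyp_cone" for A
    using frechet_derivative_cong_open[OF open_cone that _ smooth_on_openD(1)[OF smooth_grad that], of F]
      grad_ln(2) by auto
  have D2: "second_derivative log_g A B C = frechet_derivative grad_ln (at A) B \<bullet> C" if "A \<in> hyp_cone" for A B C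
    unfolding log_g_def by (rule second_derivative_ln_g[OF that])
  have neg: "second_derivative log_g A B B < 0" if "A \<in> hyp_cone" "B \<in> essential" "B \<noteq> 0" for A B
    using hessian_nonpos[OF that(1), of B] lineality_Int_essential[OF _ that(2)] that(3)
    unfolding D2[OF that(1)] by fastforce
  have eig: "\<exists>lam. garding_eigenvalues g N A B lam" if "A \<in> hyp_cone" for A B
    using factorization[OF that, of B] unfolding garding_eigenvalues_def by metis
  have sum: "second_derivative log_g A B B = - (\<Sum>j=1..N. (lam j)\<^sup>2)"
    if "A \<in> hyp_cone" "garding_eigenvalues g N A B lam" for A B lam
    using derivatives_in_eigenvalues(2)[OF that(1)] that(2) D2[OF that(1)]
    by (simp add: garding_eigenvalues_def)
  show ?thesis
    unfolding \<Gamma> E S polar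
  proof (intro conjI ballI allI impI)
    show "diffeomorphism_betw F (hyp_cone \<inter> essential) (top_of_set essential interior_of dual_cone)"
      by (rule diffeomorphism_grad[OF assms(1) grad_ln(2)])
    show "g A > 0" "GDERIV log_g A :> F A" if "A \<in> hyp_cone" for A
      using that by (simp_all add: g_pos grad_ln)
    show "A + C \<in> hyp_cone" "F (A + C) = F A" if "A \<in> hyp_cone" "C \<in> lineality" for A C
      using that by (simp_all add: grad_ln cone_add_lineality grad_add_lineality)
    show "\<exists>!A'. A' \<in> hyp_cone \<inter> essential \<and> A - A' \<in> lineality" if "A \<in> hyp_cone" for A
      by (rule ex1_essential_representative[OF that])
    show "second_derivative log_g A (B + C) (B + C) = second_derivative log_g A B B"
      if "A \<in> hyp_cone" "C \<in> lineality" for A B C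
      using that by (simp add: D2 hessian_add_lineality)
    show "second_derivative log_g A B B = - (\<Sum>j=1..N. (lam j)\<^sup>2)"
      if "A \<in> hyp_cone" "garding_eigenvalues g N A B lam" for A B lam
      by (rule sum[OF that])
    show "second_derivative log_g A B B < 0" if "A \<in> hyp_cone" "B \<in> essential" "B \<noteq> 0" for A B
      by (rule neg[OF that])
  qed (simp_all only: F D2 eig)
qed

end
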